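(* Let $\mathbf X\in\mathbb{R}^d$ have mean $\boldsymbol\theta$ and covariance $\sigma_d^2\mathrm{Id}$, $\sigma_d^2=\sigma^2/d$, and let $T/d$ be a Stein kernel for $\mathbf X-\boldsymbol\theta$ (with $\mathbf g_0\in W^{1,2}$ of the law of $\mathbf X$). With $\lambda=(d-2)\sigma_d^2$ and $\mathbf f=-\lambda\mathbf g_0$, $$E\|S_\lambda(\mathbf X)-\boldsymbol\theta\|^2\le d\sigma_d^2-\frac{(d-2)^2\sigma_d^4}{\|\boldsymbol\theta\|^2+d\sigma_d^2}+2B_\lambda,\qquad B_\lambda=|E_{\boldsymbol\theta}\langle\sigma_d^2\mathrm{Id}-T/d,\nabla\mathbf f(\mathbf X)\rangle|.$$ For a sequence of such problems indexed by $d$ with $\sigma^2$ fixed, $B_\lambda=o(1)$ if either (a) $\sup_{d\ge d_0}E_{\boldsymbol\theta}\|\mathbf X\|^{-4}<\infty$, $\mathrm{Var}(\mathrm{Tr}(T))=o(d^2)$ and $E\|T-\sigma^2\mathrm{Id}\|^2=o(d^2)$; or (b) $\mathbf g_0$ is in the closure of $C_c^\infty$ in the Sobolev norm of the law of $\sqrt d\,\mathbf X$, the law of $\sqrt d\,\mathbf X$ satisfies a Poincaré inequality with constant $C_P=o(\sqrt d)$, $E\|T\|^2\le C_P\sigma^2d$, and $\sup_{d\ge d_0}E_{\boldsymbol\theta}\|\mathbf X\|^{-6}<\infty$.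
   Context: A Stein kernel for the mean zero vector $\mathbf X-\boldsymbol\theta$ is a random matrix $K$, measurable function of $\mathbf X$ with $E\|K\|^2<\infty$, such that $E\langle\mathbf X-\boldsymbol\theta,\mathbf f(\mathbf X)\rangle=E\langle K,\nabla\mathbf f(\mathbf X)\rangle$ for all $\mathbf f$ in the weighted Sobolev space $W^{1,2}$ of the law of $\mathbf X$ ($\langle A,B\rangle=\mathrm{Tr}(AB^\top)$, $\nabla\mathbf f$ Jacobian, $\|\cdot\|$ Euclidean/Hilbert–Schmidt). Poincaré inequality with constant $C_P$ for a law of $\mathbf Z$: $\mathrm{Var}(f(\mathbf Z))\le C_PE\|\nabla f(\mathbf Z)\|^2$ for suitable $f$. $\mathbf g_0(\mathbf x)=\mathbf x/\|\mathbf x\|^2$, $S_\lambda(\mathbf x)=\mathbf x(1-\lambda/\|\mathbf x\|^2)$. *)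

theory Defs
  imports "HOL-Probability.Probability" "HOL-Library.Landau_Symbols"
begin

text \<open>Vectors of R^d are represented as functions nat => real vanishing at indices >= d,
  d x d matrices as functions nat => nat => real (only entries i,j < d matter).
  This explicit-carrier representation is needed because the dimension d varies
  inside the statement (a sequence of problems indexed by d).\<close>

type_synonym vec = "nat \<Rightarrow> real"
type_synonym mat = "nat \<Rightarrow> nat \<Rightarrow> real"

definition Rd :: "nat \<Rightarrow> vec set" where
  "Rd d = {x. \<forall>i\<ge>d. x i = 0}"

definition vinner :: "nat \<Rightarrow> vec \<Rightarrow> vec \<Rightarrow> real" where
  "vinner d x y = (\<Sum>i<d. x i * y i)"

definition vnorm :: "nat \<Rightarrow> vec \<Rightarrow> real" where
  "vnorm d x = sqrt (\<Sum>i<d. (x i)\<^sup>2)"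

definition minner :: "nat \<Rightarrow> mat \<Rightarrow> mat \<Rightarrow> real" where
  "minner d A B = (\<Sum>i<d. \<Sum>j<d. A i j * B i j)"

definition mnorm :: "nat \<Rightarrow> mat \<Rightarrow> real" where
  "mnorm d A = sqrt (minner d A A)"

definition mtrace :: "nat \<Rightarrow> mat \<Rightarrow> real" where
  "mtrace d A = (\<Sum>i<d. A i i)"

definition idm :: mat where
  "idm i j = (if i = j then 1 else 0)"

definition g0 :: "nat \<Rightarrow> vec \<Rightarrow> vec" where
  "g0 d x = (\<lambda>i. x i / (vnorm d x)\<^sup>2)"

definition shrink :: "nat \<Rightarrow> real \<Rightarrow> vec \<Rightarrow> vec" where
  "shrink d lam x = (\<lambda>i. x i * (1 - lam / (vnorm d x)\<^sup>2))"

definition pdiff :: "(vec \<Rightarrow> real) \<Rightarrow> nat \<Rightarrow> vec \<Rightarrow> real" where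
  "pdiff f j x = deriv (\<lambda>t. f (x(j := x j + t))) 0"

definition grad :: "(vec \<Rightarrow> real) \<Rightarrow> vec \<Rightarrow> vec" where
  "grad f x = (\<lambda>j. pdiff f j x)"

definition jac :: "(vec \<Rightarrow> vec) \<Rightarrow> vec \<Rightarrow> mat" where
  "jac F x = (\<lambda>i j. pdiff (\<lambda>y. F y i) j x)"

fun Ck :: "nat \<Rightarrow> nat \<Rightarrow> (vec \<Rightarrow> real) \<Rightarrow> bool" where
  "Ck d 0 f = continuous_on (Rd d) f"
| "Ck d (Suc k) f =
     (continuous_on (Rd d) f \<and>
      (\<forall>j<d. \<forall>x\<in>Rd d. (\<lambda>t. f (x(j := x j + t))) differentiable (at 0)) \<and>
      (\<forall>j<d. Ck d k (pdiff f j)))"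

definition smooth :: "nat \<Rightarrow> (vec \<Rightarrow> real) \<Rightarrow> bool" where
  "smooth d f \<longleftrightarrow> (\<forall>k. Ck d k f)"

definition Cc_inf :: "nat \<Rightarrow> (vec \<Rightarrow> real) \<Rightarrow> bool" where
  "Cc_inf d f \<longleftrightarrow> smooth d f \<and> (\<exists>R. \<forall>x\<in>Rd d. R \<le> vnorm d x \<longrightarrow> f x = 0)"

definition smooth_vec :: "nat \<Rightarrow> (vec \<Rightarrow> vec) \<Rightarrow> bool" where
  "smooth_vec d F \<longleftrightarrow> (\<forall>i<d. smooth d (\<lambda>x. F x i))"

definition Cc_inf_vec :: "nat \<Rightarrow> (vec \<Rightarrow> vec) \<Rightarrow> bool" where
  "Cc_inf_vec d F \<longleftrightarrow> (\<forall>i<d. Cc_inf d (\<lambda>x. F x i))"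

text \<open>sob_closure d M Y P F G: the pair (F, G = weak gradient of F) lies in the closure, in the
  Sobolev norm (E|F(Y)|^2 + E|grad F(Y)|^2)^(1/2) of the law of the random vector Y on M,
  of the class P of (smooth) vector fields.\<close>
definition sob_closure ::
  "nat \<Rightarrow> 'a measure \<Rightarrow> ('a \<Rightarrow> vec) \<Rightarrow> ((vec \<Rightarrow> vec) \<Rightarrow> bool) \<Rightarrow> (vec \<Rightarrow> vec) \<Rightarrow> (vec \<Rightarrow> mat) \<Rightarrow> bool"
  where
  "sob_closure d M Y P F G \<longleftrightarrow>
     (\<forall>i<d. (\<lambda>\<omega>. F (Y \<omega>) i) \<in> borel_measurable M \<and> integrable M (\<lambda>\<omega>. (F (Y \<omega>) i)\<^sup>2)) \<and>
     (\<forall>i<d. \<forall>j<d. (\<lambda>\<omega>. G (Y \<omega>) i j) \<in> borel_measurable M \<and> integrable M (\<lambda>\<omega>. (G (Y \<omega>) i j)\<^sup>2)) \<and>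
     (\<exists>\<phi>::nat \<Rightarrow> vec \<Rightarrow> vec. (\<forall>n. P (\<phi> n)) \<and>
        (\<lambda>n. \<integral>\<^sup>+\<omega>. ennreal ((vnorm d (\<lambda>i. F (Y \<omega>) i - \<phi> n (Y \<omega>) i))\<^sup>2) \<partial>M) \<longlonglongrightarrow> 0 \<and>
        (\<lambda>n. \<integral>\<^sup>+\<omega>. ennreal ((mnorm d (\<lambda>i j. G (Y \<omega>) i j - jac (\<phi> n) (Y \<omega>) i j))\<^sup>2) \<partial>M) \<longlonglongrightarrow> 0)"

definition W12 :: "nat \<Rightarrow> 'a measure \<Rightarrow> ('a \<Rightarrow> vec) \<Rightarrow> (vec \<Rightarrow> vec) \<Rightarrow> (vec \<Rightarrow> mat) \<Rightarrow> bool" where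
  "W12 d M X F G \<longleftrightarrow> sob_closure d M X (smooth_vec d) F G"

definition stein_kernel :: "nat \<Rightarrow> 'a measure \<Rightarrow> ('a \<Rightarrow> vec) \<Rightarrow> vec \<Rightarrow> ('a \<Rightarrow> mat) \<Rightarrow> bool" where
  "stein_kernel d M X \<theta> K \<longleftrightarrow>
     (\<forall>i<d. \<forall>j<d. (\<lambda>\<omega>. K \<omega> i j) \<in> borel_measurable M \<and> integrable M (\<lambda>\<omega>. (K \<omega> i j)\<^sup>2)) \<and>
     (\<forall>F G. W12 d M X F G \<longrightarrow>
        (\<integral>\<omega>. vinner d (\<lambda>i. X \<omega> i - \<theta> i) (F (X \<omega>)) \<partial>M) = (\<integral>\<omega>. minner d (K \<omega>) (G (X \<omega>)) \<partial>M))"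

definition poincare :: "nat \<Rightarrow> 'a measure \<Rightarrow> ('a \<Rightarrow> vec) \<Rightarrow> real \<Rightarrow> bool" where
  "poincare d M Z C \<longleftrightarrow>
     (\<forall>f. Cc_inf d f \<longrightarrow>
        (\<integral>\<omega>. (f (Z \<omega>) - (\<integral>\<omega>'. f (Z \<omega>') \<partial>M))\<^sup>2 \<partial>M) \<le> C * (\<integral>\<omega>. (vnorm d (grad f (Z \<omega>)))\<^sup>2 \<partial>M))"

text \<open>The standing setting: X in R^d with mean theta, covariance (sigma^2/d) Id,
  T/d a Stein kernel for X - theta with T a measurable function of X, and g_0 in W^{1,2}
  of the law of X (in particular X is a.s. nonzero, g_0 being defined off the origin).\<close>
definition stein_problem ::
  "nat \<Rightarrow> real \<Rightarrow> 'a measure \<Rightarrow> ('a \<Rightarrow> vec) \<Rightarrow> vec \<Rightarrow> (vec \<Rightarrow> mat) \<Rightarrow> bool" where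
  "stein_problem d \<sigma>2 M X \<theta> T \<longleftrightarrow>
     prob_space M \<and> \<theta> \<in> Rd d \<and> (\<forall>\<omega>\<in>space M. X \<omega> \<in> Rd d) \<and>
     (\<forall>i<d. (\<lambda>\<omega>. X \<omega> i) \<in> borel_measurable M \<and> integrable M (\<lambda>\<omega>. (X \<omega> i)\<^sup>2) \<and>
            (\<integral>\<omega>. X \<omega> i \<partial>M) = \<theta> i) \<and>
     (\<forall>i<d. \<forall>j<d. (\<integral>\<omega>. (X \<omega> i - \<theta> i) * (X \<omega> j - \<theta> j) \<partial>M) = \<sigma>2 / real d * idm i j) \<and>
     (\<forall>i j. (\<lambda>x. T x i j) \<in> borel_measurable borel) \<and>
     stein_kernel d M X \<theta> (\<lambda>\<omega> i j. T (X \<omega>) i j / real d) \<and>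
     (AE \<omega> in M. X \<omega> \<noteq> (\<lambda>_. 0)) \<and>
     W12 d M X (g0 d) (jac (g0 d))"

definition lam :: "nat \<Rightarrow> real \<Rightarrow> real" where
  "lam d \<sigma>2 = (real d - 2) * (\<sigma>2 / real d)"

definition Blam :: "nat \<Rightarrow> real \<Rightarrow> 'a measure \<Rightarrow> ('a \<Rightarrow> vec) \<Rightarrow> (vec \<Rightarrow> mat) \<Rightarrow> real" where
  "Blam d \<sigma>2 M X T =
     \<bar>\<integral>\<omega>. minner d (\<lambda>i j. \<sigma>2 / real d * idm i j - T (X \<omega>) i j / real d)
                    (jac (\<lambda>x i. - lam d \<sigma>2 * g0 d x i) (X \<omega>)) \<partial>M\<bar>"

end

(*
  With J the Jacobian of g0, Stein's identity and <Id, J> = (d - 2)/|x|^2 turn the risk into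
  sigma^2 - lam^2 E|X|^-2 + 2 lam E<s Id - T/d, J>, s = sigma^2/d, and Jensen's inequality gives
  the bound.  Since J = Id/|x|^2 - 2 x x^t/|x|^4 and E Tr T = d sigma^2 (Stein's identity for the
  identity map), B_lam is at most
    sigma^2/d (sqrt (Var (Tr T) Var (|X|^-2)) + 2 sqrt (E|T - sigma^2 Id|^2 E|X|^-4)).
  This settles (a).  In (b), the Poincare inequality for |z|^-2 bounds Var (|X|^-2) by a multiple
  of C_P E|X|^-6 / d, while Var (Tr T) <= d E|T - sigma^2 Id|^2 <= d E|T|^2.  As |z|^-2 is not
  a test function, it is approximated by chi(|z|^2/n) / (|z|^2 + 1/n), with chi a smooth cutoff
  for which |gradient| <= const |z|^-3 uniformly in n.
*)
theory Submission
  imports Defs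
begin

text \<open>The trace part is separated because it is the delicate one in (b). From E|T|^2 \<le> C_P
  sigma^2 d one only gets Var(Tr T) of order C_P d^2, so after the prefactor 1/d a plain
  Cauchy-Schwarz bound against E|X|^-4 would leave sqrt(C_P), which need not tend to 0. Since Tr T
  is centred by its known mean, only the fluctuation of |X|^-2 enters, and the Poincare inequality
  for sqrt(d) X makes its standard deviation of order sqrt(C_P / d). The product is C_P / sqrt(d),
  whence the hypothesis C_P = o(sqrt(d)). Test functions must be smooth to every order, in the sense
  of iterated partial derivatives. Formulas for higher derivatives are avoided: the cutoff is built
  from the functions exp(-1/u) / u^k, and smoothness is proved at once for a class of functions that
  contains the partial derivatives of its members.\<close>

section \<open>A family of flat functions stable under differentiation\<close>

definition flat :: "nat \<Rightarrow> real \<Rightarrow> real" where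
  "flat k u = (if 0 < u then exp (- (1 / u)) / u ^ k else 0)"

lemma flat_nonneg: "0 \<le> flat k u"
  by (simp add: flat_def)

lemma flat_eq_times_flat_Suc: "flat k u = u * flat (Suc k) u"
  by (simp add: flat_def)

text \<open>With v = 1/u this is v^k / k! \<le> exp v: a single term of the exponential series is at
  most its sum.\<close>

lemma flat_le_fact: "flat k u \<le> fact k"
proof (cases "0 < u")
  case True
  define v where "v = 1 / u"
  have v: "0 < v" using True by (simp add: v_def)
  have "v ^ k / fact k \<le> exp v"
  proof -
    have s: "(\<lambda>n. v ^ n / fact n) sums exp v"
      using exp_converges[of v] by (simp add: field_simps)
    have "(\<Sum>n\<in>{k}. v ^ n / fact n) \<le> (\<Sum>n. v ^ n / fact n)"
      using v by (intro sum_le_suminf) (auto intro: sums_summable[OF s])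
    then show ?thesis using sums_unique[OF s] by simp
  qed
  then have "v ^ k * exp (- v) \<le> fact k"
    by (simp add: exp_minus field_simps)
  then show ?thesis using True by (simp add: flat_def v_def field_simps power_one_over)
qed (simp add: flat_def)

text \<open>Two factors u are traded for raising the index by two. The quadratic vanishing at 0 is
  what makes the difference quotient there tend to 0.\<close>

lemma abs_flat_le: "\<bar>flat k u\<bar> \<le> fact (Suc (Suc k)) * u\<^sup>2"
proof -
  have "flat k u = u\<^sup>2 * flat (Suc (Suc k)) u"
    using flat_eq_times_flat_Suc[of k u] flat_eq_times_flat_Suc[of "Suc k" u]
    by (simp add: power2_eq_square)
  moreover have "u\<^sup>2 * flat (Suc (Suc k)) u \<le> u\<^sup>2 * fact (Suc (Suc k))"
    by (intro mult_left_mono flat_le_fact) auto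
  ultimately show ?thesis by (simp add: flat_nonneg mult.commute)
qed

text \<open>For negative u and at 0 the right-hand side is 0, so one formula serves all cases; only
  the gluing point 0 needs an estimate.\<close>

lemma flat_has_derivative:
  "(flat k has_real_derivative flat (Suc (Suc k)) u - real k * flat (Suc k) u) (at u)"
proof (cases u "0::real" rule: linorder_cases)
  case less
  have "((\<lambda>_. 0) has_real_derivative 0) (at u)" by simp
  then have "(flat k has_real_derivative 0) (at u)"
    by (rule has_field_derivative_transform_within_open[where S = "{..<0}"])
       (use less in \<open>auto simp: flat_def\<close>)
  then show ?thesis using less by (simp add: flat_def)
next
  case equal
  have "((\<lambda>h. flat k h / h) \<longlongrightarrow> 0) (at 0)"
  proof (rule Lim_null_comparison)
    show "\<forall>\<^sub>F h in at 0. norm (flat k h / h) \<le> fact (Suc (Suc k)) * \<bar>h\<bar>"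
    proof (intro always_eventually allI)
      fix h :: real
      show "norm (flat k h / h) \<le> fact (Suc (Suc k)) * \<bar>h\<bar>"
        using abs_flat_le[of k h]
        by (cases "h = 0") (simp_all add: divide_le_eq power2_eq_square mult.assoc del: fact_Suc)
    qed
    show "((\<lambda>h. fact (Suc (Suc k)) * \<bar>h\<bar>) \<longlongrightarrow> (0::real)) (at 0)"
      by (rule tendsto_eq_intros tendsto_rabs | simp)+
  qed
  then show ?thesis using equal by (simp add: DERIV_def flat_def)
next
  case greater
  have "((\<lambda>u. exp (- (1 / u)) / u ^ k) has_real_derivative
      flat (Suc (Suc k)) u - real k * flat (Suc k) u) (at u)"
    using greater
    by (auto intro!: derivative_eq_intros simp: flat_def, cases k)
       (auto simp: field_simps power2_eq_square)
  then show ?thesis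
    by (rule has_field_derivative_transform_within_open[where S = "{0<..}"])
       (use greater in \<open>auto simp: flat_def\<close>)
qed

section \<open>Smoothness of functions built from the squared norm\<close>

text \<open>The polynomial form avoids the square root in \<open>vnorm\<close>, which is not
  differentiable at the origin.\<close>

definition sqn :: "nat \<Rightarrow> vec \<Rightarrow> real" where
  "sqn d x = (\<Sum>i<d. (x i)\<^sup>2)"

text \<open>The generators are chosen so that the class is stable under partial derivatives: the
  chain rule through \<open>sqn\<close> produces a coordinate, differentiating \<open>flat\<close>
  only shifts its index, and the derivative of the reciprocal is a multiple of its square times a
  coordinate.\<close>

inductive cutoff_algebra :: "nat \<Rightarrow> real \<Rightarrow> (vec \<Rightarrow> real) \<Rightarrow> bool" for d n where
  const: "cutoff_algebra d n (\<lambda>_. c)"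
| coord: "cutoff_algebra d n (\<lambda>x. x i)"
| flat: "cutoff_algebra d n (\<lambda>x. flat k (1 - sqn d x / n))"
| recip: "cutoff_algebra d n (\<lambda>x. 1 / (sqn d x + 1 / n))"
| add: "cutoff_algebra d n f \<Longrightarrow> cutoff_algebra d n g \<Longrightarrow> cutoff_algebra d n (\<lambda>x. f x + g x)"
| mult: "cutoff_algebra d n f \<Longrightarrow> cutoff_algebra d n g \<Longrightarrow> cutoff_algebra d n (\<lambda>x. f x * g x)"

lemma sqn_nonneg: "0 \<le> sqn d x"
  by (simp add: sqn_def sum_nonneg)

lemma sqn_add_pos: "0 < n \<Longrightarrow> 0 < sqn d x + 1 / n"
  using sqn_nonneg[of d x] by (simp add: add_nonneg_pos)

lemma sqn_fun_upd: "j < d \<Longrightarrow> sqn d (x(j := x j + t)) = sqn d x + 2 * x j * t + t\<^sup>2"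
proof -
  assume j: "j < d"
  have "(x(j := x j + t)) i ^ 2 = (x i)\<^sup>2 + (if i = j then 2 * x j * t + t\<^sup>2 else 0)" for i
    by (auto simp: power2_eq_square algebra_simps)
  then show ?thesis using j by (simp add: sqn_def sum.distrib)
qed

lemma sqn_has_partial:
  assumes "j < d"
  shows "((\<lambda>t. sqn d (x(j := x j + t))) has_real_derivative 2 * x j) (at 0)"
  unfolding sqn_fun_upd[OF assms] by (auto intro!: derivative_eq_intros)

lemma continuous_sqn: "continuous_on A (sqn d)"
  unfolding sqn_def
  by (intro continuous_intros continuous_on_subset[OF continuous_on_product_coordinates]) auto

lemma cutoff_algebra_continuous:
  assumes "cutoff_algebra d n f" "0 < n"
  shows "continuous_on A f"
  using assms(1)
proof induction
  case (coord i)
  show ?case by (rule continuous_on_subset[OF continuous_on_product_coordinates]) auto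
next
  case (flat k)
  have "continuous_on UNIV (flat k)"
    using flat_has_derivative DERIV_continuous by (blast intro: continuous_at_imp_continuous_on)
  then show ?case
    by (rule continuous_on_compose2) (use \<open>0 < n\<close> in \<open>auto intro!: continuous_intros continuous_sqn\<close>)
next
  case recip
  show ?case using sqn_add_pos[OF \<open>0 < n\<close>]
    by (intro continuous_intros continuous_sqn) (auto simp: less_imp_neq[symmetric])
qed (auto intro: continuous_intros)

lemma cutoff_algebra_partial:
  assumes "cutoff_algebra d n f" "0 < n" "j < d"
  shows "\<exists>f'. cutoff_algebra d n f' \<and>
    (\<forall>x. ((\<lambda>t. f (x(j := x j + t))) has_real_derivative f' x) (at 0))"
  using assms(1)
proof induction
  case (const c)
  show ?case by (intro exI[of _ "\<lambda>_. 0"]) (auto intro: cutoff_algebra.const)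
next
  case (coord i)
  show ?case
    by (intro exI[of _ "\<lambda>_. if i = j then 1 else 0"])
       (auto intro: cutoff_algebra.const intro!: derivative_eq_intros)
next
  case (flat k)
  let ?u = "\<lambda>x. 1 - sqn d x / n"
  let ?f' = "\<lambda>x. (flat (Suc (Suc k)) (?u x) + (- real k) * flat (Suc k) (?u x)) * (- 2 / n * x j)"
  have "((\<lambda>t. flat k (?u (x(j := x j + t)))) has_real_derivative ?f' x) (at 0)" for x
    by (rule DERIV_chain2[THEN DERIV_cong, OF flat_has_derivative])
       (use \<open>0 < n\<close> in \<open>auto intro!: derivative_eq_intros sqn_has_partial \<open>j < d\<close>\<close>)
  moreover have "cutoff_algebra d n ?f'"
    by (intro cutoff_algebra.intros)
  ultimately show ?case by blast
next
  case recip
  let ?r = "\<lambda>x. 1 / (sqn d x + 1 / n)"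
  let ?f' = "\<lambda>x. (?r x * ?r x) * (- 2 * x j)"
  have "((\<lambda>t. ?r (x(j := x j + t))) has_real_derivative ?f' x) (at 0)" for x
    using sqn_add_pos[OF \<open>0 < n\<close>, of d x]
    by (auto intro!: derivative_eq_intros sqn_has_partial \<open>j < d\<close>)
  moreover have "cutoff_algebra d n ?f'"
    by (intro cutoff_algebra.intros)
  ultimately show ?case by blast
next
  case (add f g)
  then obtain f' g' where "cutoff_algebra d n f'" "cutoff_algebra d n g'"
    "\<And>x. ((\<lambda>t. f (x(j := x j + t))) has_real_derivative f' x) (at 0)"
    "\<And>x. ((\<lambda>t. g (x(j := x j + t))) has_real_derivative g' x) (at 0)" by blast
  then show ?case
    by (intro exI[of _ "\<lambda>x. f' x + g' x"] conjI cutoff_algebra.add allI DERIV_add)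
next
  case (mult f g)
  then obtain f' g' where "cutoff_algebra d n f'" "cutoff_algebra d n g'"
    and D: "\<And>x. ((\<lambda>t. f (x(j := x j + t))) has_real_derivative f' x) (at 0)"
    "\<And>x. ((\<lambda>t. g (x(j := x j + t))) has_real_derivative g' x) (at 0)" by blast
  moreover have "((\<lambda>t. f (x(j := x j + t)) * g (x(j := x j + t))) has_real_derivative
      f' x * g x + g' x * f x) (at 0)" for x
    using DERIV_mult[OF D(1)[of x] D(2)[of x]] by simp
  ultimately show ?case using mult.hyps
    by (intro exI[of _ "\<lambda>x. f' x * g x + g' x * f x"] conjI cutoff_algebra.add cutoff_algebra.mult allI)
qed

text \<open>Induction on the order k for all members at once: each \<open>pdiff f j\<close> is again
  a member, so the induction hypothesis applies to it.\<close>

lemma cutoff_algebra_smooth: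
  assumes "cutoff_algebra d n f" "0 < n"
  shows "smooth d f"
  unfolding smooth_def
proof
  fix k show "Ck d k f"
    using assms(1)
  proof (induction k arbitrary: f)
    case 0
    then show ?case by (simp add: cutoff_algebra_continuous \<open>0 < n\<close>)
  next
    case (Suc k)
    have "(\<lambda>t. f (x(j := x j + t))) differentiable (at 0)" "Ck d k (pdiff f j)" if j: "j < d" for j x
    proof -
      obtain f' where f': "cutoff_algebra d n f'"
        "\<And>x. ((\<lambda>t. f (x(j := x j + t))) has_real_derivative f' x) (at 0)"
        using cutoff_algebra_partial[OF Suc.prems \<open>0 < n\<close> j] by blast
      then show "(\<lambda>t. f (x(j := x j + t))) differentiable (at 0)"
        using real_differentiable_def by blast
      have "pdiff f j = f'" using f'(2) by (auto simp: pdiff_def fun_eq_iff intro: DERIV_imp_deriv)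
      then show "Ck d k (pdiff f j)" using Suc.IH f'(1) by simp
    qed
    then show ?case using cutoff_algebra_continuous[OF Suc.prems \<open>0 < n\<close>] by simp
  qed
qed

section \<open>Compactly supported approximation of the inverse squared norm\<close>

text \<open>The factor \<open>exp 1\<close> normalises the cutoff to 1 at the origin, since
  \<open>flat 0 1\<close> is exp(-1). The cutoff vanishes for |x|^2 \<ge> n, and the shift 1/n
  removes the singularity at 0.\<close>

definition trunc_recip :: "nat \<Rightarrow> real \<Rightarrow> vec \<Rightarrow> real" where
  "trunc_recip d n x = exp 1 * flat 0 (1 - sqn d x / n) * (1 / (sqn d x + 1 / n))"

lemma vnorm_sqn: "vnorm d x = sqrt (sqn d x)"
  by (simp add: vnorm_def sqn_def)

lemma vnorm_sq: "(vnorm d x)\<^sup>2 = sqn d x"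
  by (simp add: vnorm_sqn sqn_nonneg)

lemma Cc_inf_trunc_recip:
  assumes "0 < n"
  shows "Cc_inf d (trunc_recip d n)"
  unfolding Cc_inf_def
proof
  show "smooth d (trunc_recip d n)"
    unfolding trunc_recip_def by (intro cutoff_algebra_smooth[OF _ assms] cutoff_algebra.intros)
  have "trunc_recip d n x = 0" if "sqrt n \<le> vnorm d x" for x
    using that assms by (simp add: trunc_recip_def flat_def vnorm_sqn)
  then show "\<exists>R. \<forall>x\<in>Rd d. R \<le> vnorm d x \<longrightarrow> trunc_recip d n x = 0" by blast
qed

lemma flat0_le: "u \<le> 1 \<Longrightarrow> exp 1 * flat 0 u \<le> 1"
  by (auto simp: flat_def exp_add[symmetric] mult_exp_exp)

text \<open>The bounds are uniform in n and so provide the majorant for dominated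
  convergence.\<close>

lemma trunc_recip_bounds:
  assumes "0 < n" "0 < sqn d x"
  shows "0 \<le> trunc_recip d n x" "trunc_recip d n x \<le> 1 / sqn d x"
proof -
  show "0 \<le> trunc_recip d n x"
    using assms by (simp add: trunc_recip_def flat_nonneg)
  have "trunc_recip d n x \<le> 1 * (1 / sqn d x)"
    unfolding trunc_recip_def using assms
    by (intro mult_mono flat0_le) (auto simp: frac_le flat_nonneg)
  then show "trunc_recip d n x \<le> 1 / sqn d x" by simp
qed

lemma trunc_recip_tendsto:
  assumes "0 < sqn d x"
  shows "(\<lambda>n. trunc_recip d (real (Suc n)) x) \<longlonglongrightarrow> 1 / sqn d x"
proof -
  have c: "isCont (flat 0) 1" using flat_has_derivative DERIV_continuous by blast
  have i: "(\<lambda>n. 1 / real (Suc n)) \<longlonglongrightarrow> 0" using LIMSEQ_inverse_real_of_nat by (simp add: inverse_eq_divide)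
  have "(\<lambda>n. 1 - sqn d x * (1 / real (Suc n))) \<longlonglongrightarrow> 1 - sqn d x * 0"
    by (intro tendsto_intros i)
  then have u: "(\<lambda>n. 1 - sqn d x / real (Suc n)) \<longlonglongrightarrow> 1" by simp
  have "(\<lambda>n. trunc_recip d (real (Suc n)) x) \<longlonglongrightarrow> exp 1 * flat 0 1 * (1 / (sqn d x + 0))"
    unfolding trunc_recip_def
    by (intro tendsto_intros isCont_tendsto_compose[OF c] u i) (use assms in auto)
  then show ?thesis by (simp add: flat_def mult_exp_exp)
qed

text \<open>Differentiating the cutoff costs a factor 1/n, but only where |x|^2 < n, so it costs no
  more than 1/|x|^2, like differentiating the reciprocal itself. In the constant, 2e comes from
  \<open>flat 2\<close> \<le> 2!, the 1 from the reciprocal, and 4 from the squared gradient 4|x|^2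
  of |x|^2.\<close>

lemma grad_trunc_recip_le:
  assumes "0 < n" "0 < sqn d x"
  shows "(vnorm d (grad (trunc_recip d n) x))\<^sup>2 \<le> 4 * (2 * exp 1 + 1)\<^sup>2 * (1 / sqn d x) ^ 3"
proof -
  let ?s = "sqn d x" let ?u = "1 - sqn d x / n"
  \<comment> \<open>\<open>h\<close> is the derivative with respect to the variable s = |x|^2, so
    that the gradient is 2 x h.\<close>
  define h where "h = exp 1 * flat 2 ?u * (- 1 / n) * (1 / (?s + 1 / n)) - exp 1 * flat 0 ?u * (1 / (?s + 1 / n)\<^sup>2)"
  have grad: "grad (trunc_recip d n) x j = 2 * x j * h" if j: "j < d" for j
  proof -
    have "((\<lambda>t. flat 0 (1 - sqn d (x(j := x j + t)) / n)) has_real_derivative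
        flat 2 ?u * (- 2 * x j / n)) (at 0)"
      by (rule DERIV_chain2[THEN DERIV_cong, OF flat_has_derivative])
         (use \<open>0 < n\<close> in \<open>auto intro!: derivative_eq_intros sqn_has_partial j simp: numeral_2_eq_2\<close>)
    moreover have "((\<lambda>t. 1 / (sqn d (x(j := x j + t)) + 1 / n)) has_real_derivative
        - (2 * x j) * (1 / (?s + 1 / n)\<^sup>2)) (at 0)"
      using sqn_add_pos[OF \<open>0 < n\<close>, of d x]
      by (auto intro!: derivative_eq_intros sqn_has_partial j simp: power2_eq_square)
    ultimately have "((\<lambda>t. trunc_recip d n (x(j := x j + t))) has_real_derivative 2 * x j * h) (at 0)"
      unfolding trunc_recip_def h_def
      by (rule DERIV_cong[OF DERIV_mult[OF DERIV_cmult]]) (simp add: algebra_simps)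
    then show ?thesis by (simp add: grad_def pdiff_def DERIV_imp_deriv)
  qed
  have "(vnorm d (grad (trunc_recip d n) x))\<^sup>2 = 4 * ?s * h\<^sup>2"
    by (simp add: vnorm_sq) (simp add: sqn_def grad power_mult_distrib sum_distrib_left sum_distrib_right)
  also have "\<bar>h\<bar> \<le> (2 * exp 1 + 1) / ?s\<^sup>2"
  proof -
    \<comment> \<open>On the support of the cutoff 1/n is less than 1/s; off it the left side is
      0.\<close>
    have "flat 2 ?u / n \<le> 2 / ?s"
    proof (cases "?s < n")
      case True
      then show ?thesis using flat_le_fact[of 2 ?u] assms
        by (intro frac_le) (auto simp: fact_numeral)
    next
      case False
      then show ?thesis using assms by (simp add: flat_def)
    qed
    then have "exp 1 * (flat 2 ?u / n) * (1 / (?s + 1 / n)) \<le> exp 1 * (2 / ?s) * (1 / ?s)"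
      using assms by (intro mult_mono) (auto simp: flat_nonneg frac_le)
    moreover have "exp 1 * flat 0 ?u * (1 / (?s + 1 / n)\<^sup>2) \<le> 1 * (1 / ?s\<^sup>2)"
      using assms by (intro mult_mono flat0_le) (auto simp: flat_nonneg intro!: frac_le power_mono)
    moreover have "0 \<le> exp 1 * (flat 2 ?u / n) * (1 / (?s + 1 / n))"
      "0 \<le> exp 1 * flat 0 ?u * (1 / (?s + 1 / n)\<^sup>2)"
      using assms by (auto simp: flat_nonneg)
    ultimately have "\<bar>h\<bar> \<le> exp 1 * (2 / ?s) * (1 / ?s) + 1 * (1 / ?s\<^sup>2)"
      unfolding h_def by (simp add: abs_le_iff)
    also have "\<dots> = (2 * exp 1 + 1) / ?s\<^sup>2"
      using assms by (simp add: power2_eq_square add_divide_distrib)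
    finally show ?thesis .
  qed
  then have "4 * ?s * h\<^sup>2 \<le> 4 * ?s * ((2 * exp 1 + 1) / ?s\<^sup>2)\<^sup>2"
    using assms by (intro mult_left_mono) (auto simp: abs_le_square_iff[symmetric])
  also have "\<dots> = 4 * (2 * exp 1 + 1)\<^sup>2 * (1 / ?s) ^ 3"
    using assms by (simp add: power_divide) (simp add: field_simps eval_nat_numeral)
  finally show ?thesis .
qed

section \<open>Square-integrable functions and the Cauchy-Schwarz inequality\<close>

definition square_integrable :: "'a measure \<Rightarrow> ('a \<Rightarrow> real) \<Rightarrow> bool" where
  "square_integrable M f \<longleftrightarrow> f \<in> borel_measurable M \<and> integrable M (\<lambda>\<omega>. (f \<omega>)\<^sup>2)"

lemma square_integrable_measurable: "square_integrable M f \<Longrightarrow> f \<in> borel_measurable M"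
  by (simp add: square_integrable_def)

lemma square_integrable_mult_integrable:
  assumes "square_integrable M f" "square_integrable M g"
  shows "integrable M (\<lambda>\<omega>. f \<omega> * g \<omega>)"
proof (rule Bochner_Integration.integrable_bound)
  show "integrable M (\<lambda>\<omega>. (f \<omega>)\<^sup>2 + (g \<omega>)\<^sup>2)" using assms by (simp add: square_integrable_def)
  show "(\<lambda>\<omega>. f \<omega> * g \<omega>) \<in> borel_measurable M"
    using assms by (intro borel_measurable_times) (auto simp: square_integrable_def)
  have "\<bar>a * b\<bar> \<le> a\<^sup>2 + b\<^sup>2" for a b :: real
    using sum_squares_bound[of "\<bar>a\<bar>" "\<bar>b\<bar>"] mult_nonneg_nonneg[OF abs_ge_zero[of a] abs_ge_zero[of b]]
    unfolding abs_mult power2_abs by linarith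
  then show "AE \<omega> in M. norm (f \<omega> * g \<omega>) \<le> norm ((f \<omega>)\<^sup>2 + (g \<omega>)\<^sup>2)" by simp
qed

lemma square_integrable_cmult: "square_integrable M f \<Longrightarrow> square_integrable M (\<lambda>\<omega>. c * f \<omega>)"
  by (auto simp: square_integrable_def power_mult_distrib)

lemma square_integrable_add:
  assumes "square_integrable M f" "square_integrable M g"
  shows "square_integrable M (\<lambda>\<omega>. f \<omega> + g \<omega>)"
  using assms square_integrable_mult_integrable[OF assms]
  by (auto simp: square_integrable_def power2_sum mult.assoc)

lemma square_integrable_diff:
  assumes "square_integrable M f" "square_integrable M g"
  shows "square_integrable M (\<lambda>\<omega>. f \<omega> - g \<omega>)"
  using square_integrable_add[OF assms(1) square_integrable_cmult[OF assms(2), of "- 1"]] by simp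

lemma square_integrable_sum:
  "(\<And>i. i \<in> I \<Longrightarrow> square_integrable M (f i)) \<Longrightarrow> square_integrable M (\<lambda>\<omega>. \<Sum>i\<in>I. f i \<omega>)"
proof (induction I rule: infinite_finite_induct)
  case (insert i I)
  then show ?case by (simp add: square_integrable_add)
qed (auto simp: square_integrable_def)

lemma Cauchy_Schwarz_integral:
  assumes "square_integrable M f" "square_integrable M g"
  shows "\<bar>\<integral>\<omega>. f \<omega> * g \<omega> \<partial>M\<bar> \<le> sqrt (\<integral>\<omega>. (f \<omega>)\<^sup>2 \<partial>M) * sqrt (\<integral>\<omega>. (g \<omega>)\<^sup>2 \<partial>M)"
proof -
  define a where "a = (\<integral>\<omega>. (f \<omega>)\<^sup>2 \<partial>M)"
  define b where "b = (\<integral>\<omega>. f \<omega> * g \<omega> \<partial>M)"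
  define c where "c = (\<integral>\<omega>. (g \<omega>)\<^sup>2 \<partial>M)"
  note int = assms[unfolded square_integrable_def] square_integrable_mult_integrable[OF assms]
  have "b\<^sup>2 \<le> a * c"
  proof (cases "c = 0")
    case True
    then have "AE \<omega> in M. (g \<omega>)\<^sup>2 = 0"
      unfolding c_def using int by (subst (asm) integral_nonneg_eq_0_iff_AE) auto
    then have "AE \<omega> in M. f \<omega> * g \<omega> = 0" by auto
    then have "b = 0" unfolding b_def by (rule integral_eq_zero_AE)
    then show ?thesis using True by simp
  next
    case False
    then have c: "0 < c" unfolding c_def by (simp add: order.not_eq_order_implies_strict)
    \<comment> \<open>\<open>b / c\<close> minimises the quadratic E(f - t g)^2 in t.\<close>
    have "0 \<le> (\<integral>\<omega>. (f \<omega> - b / c * g \<omega>)\<^sup>2 \<partial>M)" by simp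
    also have "(\<integral>\<omega>. (f \<omega> - b / c * g \<omega>)\<^sup>2 \<partial>M)
        = (\<integral>\<omega>. (f \<omega>)\<^sup>2 - 2 * (b / c) * (f \<omega> * g \<omega>) + (b / c)\<^sup>2 * (g \<omega>)\<^sup>2 \<partial>M)"
      by (intro arg_cong[where f = "integral\<^sup>L M"] ext) (simp add: power2_eq_square algebra_simps)
    also have "\<dots> = a - 2 * (b / c) * b + (b / c)\<^sup>2 * c"
      using int by (simp add: a_def b_def c_def)
    also have "\<dots> = a - b\<^sup>2 / c" using c by (simp add: power2_eq_square field_simps)
    finally show ?thesis using c by (simp add: field_simps)
  qed
  then have "\<bar>b\<bar> \<le> sqrt (a * c)" using real_le_rsqrt[of "\<bar>b\<bar>"] by simp
  then show ?thesis by (simp add: a_def b_def c_def real_sqrt_mult)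
qed

section \<open>Matrix inequalities and the Jacobian of x / |x|^2\<close>

text \<open>Because 1/0 = 0 this holds at the origin too, which lets some later identities and
  bounds hold at every point instead of almost everywhere.\<close>

lemma sqn_mult_recip_sq: "sqn d x * (1 / sqn d x)\<^sup>2 = 1 / sqn d x"
  by (simp add: power2_eq_square)

definition qform :: "nat \<Rightarrow> mat \<Rightarrow> vec \<Rightarrow> real" where
  "qform d A x = (\<Sum>i<d. \<Sum>j<d. A i j * (x i * x j))"

lemma mnorm_sq: "(mnorm d A)\<^sup>2 = minner d A A"
  by (simp add: mnorm_def minner_def sum_nonneg)

text \<open>The quadratic form is the matrix inner product of A with x x^t, and x x^t has
  Hilbert-Schmidt norm |x|^2; Cauchy-Schwarz is applied over pairs of indices.\<close>

lemma abs_qform_le: "\<bar>qform d A x\<bar> \<le> mnorm d A * sqn d x"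
proof -
  let ?I = "{..<d} \<times> {..<d}"
  have "(qform d A x)\<^sup>2 = (\<Sum>p\<in>?I. (\<lambda>(i, j). A i j) p * (\<lambda>(i, j). x i * x j) p)\<^sup>2"
    by (simp add: qform_def sum.cartesian_product case_prod_beta)
  also have "\<dots> \<le> (\<Sum>p\<in>?I. ((\<lambda>(i, j). A i j) p)\<^sup>2) * (\<Sum>p\<in>?I. ((\<lambda>(i, j). x i * x j) p)\<^sup>2)"
    by (rule Cauchy_Schwarz_ineq_sum)
  also have "(\<Sum>p\<in>?I. ((\<lambda>(i, j). A i j) p)\<^sup>2) = (mnorm d A)\<^sup>2"
    unfolding mnorm_sq by (simp add: minner_def sum.cartesian_product case_prod_beta power2_eq_square)
  also have "(\<Sum>p\<in>?I. ((\<lambda>(i, j). x i * x j) p)\<^sup>2) = (sqn d x)\<^sup>2"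
    by (simp add: sqn_def power2_eq_square[of "sum _ _"] sum_product sum.cartesian_product
        case_prod_beta power_mult_distrib)
  finally have "(qform d A x)\<^sup>2 \<le> (mnorm d A * sqn d x)\<^sup>2" by (simp add: power_mult_distrib)
  then have "\<bar>qform d A x\<bar> \<le> \<bar>mnorm d A * sqn d x\<bar>" by (rule abs_le_square_iff[THEN iffD2])
  moreover have "0 \<le> mnorm d A" by (simp add: mnorm_def minner_def sum_nonneg)
  ultimately show ?thesis by (simp add: sqn_nonneg)
qed

text \<open>Cauchy-Schwarz of the diagonal against the vector of ones, after which the off-diagonal
  entries are added.\<close>

lemma mtrace_sq_le: "(mtrace d A)\<^sup>2 \<le> real d * (mnorm d A)\<^sup>2"
proof -
  have "(mtrace d A)\<^sup>2 = (\<Sum>i<d. 1 * A i i)\<^sup>2" by (simp add: mtrace_def)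
  also have "\<dots> \<le> (\<Sum>i<d. 1\<^sup>2) * (\<Sum>i<d. (A i i)\<^sup>2)" by (rule Cauchy_Schwarz_ineq_sum)
  also have "\<dots> \<le> real d * (\<Sum>i<d. \<Sum>j<d. (A i j)\<^sup>2)"
    by simp (intro mult_left_mono sum_mono, auto intro: member_le_sum)
  finally show ?thesis unfolding mnorm_sq by (simp add: minner_def power2_eq_square)
qed

lemma minner_idm: "minner d A idm = mtrace d A"
  by (simp add: minner_def mtrace_def idm_def if_distrib[of "\<lambda>x. _ * x"] cong: if_cong)

lemma g0_eq: "g0 d x i = x i / sqn d x"
  by (simp add: g0_def vnorm_sq)

lemma g0_has_partial:
  assumes "j < d" "0 < sqn d x"
  shows "((\<lambda>t. g0 d (x(j := x j + t)) i) has_real_derivative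
    idm i j / sqn d x - 2 * (x i * x j) * (1 / sqn d x)\<^sup>2) (at 0)"
proof -
  have "((\<lambda>t. (x(j := x j + t)) i) has_real_derivative idm i j) (at 0)"
    by (auto simp: idm_def intro!: derivative_eq_intros)
  from DERIV_divide[OF this sqn_has_partial[OF assms(1)]] assms(2)
  have "((\<lambda>t. (x(j := x j + t)) i / sqn d (x(j := x j + t))) has_real_derivative
      (idm i j * sqn d x - x i * (2 * x j)) / (sqn d x * sqn d x)) (at 0)" by simp
  then show ?thesis unfolding g0_eq
    by (rule DERIV_cong) (use assms(2) in \<open>simp add: field_simps power2_eq_square\<close>)
qed

lemma jac_scaled_g0:
  assumes "j < d" "0 < sqn d x"
  shows "jac (\<lambda>x i. c * g0 d x i) x i j = c * (idm i j / sqn d x - 2 * (x i * x j) * (1 / sqn d x)\<^sup>2)"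
  unfolding jac_def pdiff_def
  by (intro DERIV_imp_deriv DERIV_cmult g0_has_partial assms)

lemma jac_g0:
  assumes "j < d" "0 < sqn d x"
  shows "jac (g0 d) x i j = idm i j / sqn d x - 2 * (x i * x j) * (1 / sqn d x)\<^sup>2"
  using jac_scaled_g0[OF assms, of 1] by simp

lemma minner_jac_g0:
  assumes "0 < sqn d x"
  shows "minner d A (jac (g0 d) x) = mtrace d A * (1 / sqn d x) - 2 * (qform d A x * (1 / sqn d x)\<^sup>2)"
proof -
  have "minner d A (jac (g0 d) x)
      = (\<Sum>i<d. \<Sum>j<d. A i j * idm i j * (1 / sqn d x) - 2 * (A i j * (x i * x j) * (1 / sqn d x)\<^sup>2))"
    unfolding minner_def
    by (intro sum.cong refl) (simp add: jac_g0 assms algebra_simps)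
  also have "\<dots> = minner d A idm * (1 / sqn d x) - 2 * (qform d A x * (1 / sqn d x)\<^sup>2)"
    by (simp only: sum_subtractf minner_def qform_def sum_distrib_left sum_distrib_right)
  finally show ?thesis by (simp add: minner_idm)
qed

lemma minner_jac_scaled_g0:
  assumes "0 < sqn d x"
  shows "minner d A (jac (\<lambda>x i. c * g0 d x i) x) = c * minner d A (jac (g0 d) x)"
  unfolding minner_def sum_distrib_left
  by (intro sum.cong refl) (simp add: jac_scaled_g0 jac_g0 assms)

lemma sqn_eq_0_iff: "x \<in> Rd d \<Longrightarrow> sqn d x = 0 \<longleftrightarrow> x = (\<lambda>_. 0)"
  by (auto simp: sqn_def sum_nonneg_eq_0_iff Rd_def fun_eq_iff) (metis lessThan_iff not_less)

lemma mtrace_jac_g0: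
  assumes "0 < sqn d x"
  shows "mtrace d (jac (g0 d) x) = (real d - 2) * (1 / sqn d x)"
proof -
  have "mtrace d (jac (g0 d) x) = (\<Sum>i<d. 1 / sqn d x - 2 * ((x i)\<^sup>2 * (1 / sqn d x)\<^sup>2))"
    unfolding mtrace_def
    by (intro sum.cong refl) (simp add: jac_g0 assms idm_def power2_eq_square)
  also have "\<dots> = real d * (1 / sqn d x) - 2 * (sqn d x * (1 / sqn d x)\<^sup>2)"
    by (simp only: sum_subtractf sqn_def sum_distrib_left[symmetric] sum_distrib_right[symmetric]) simp
  finally show ?thesis by (simp only: sqn_mult_recip_sq) (simp add: algebra_simps)
qed

text \<open>|x|^2 times the Jacobian is the reflection Id - 2 x x^t / |x|^2, an orthogonal matrix,
  whose squared Hilbert-Schmidt norm is d.\<close>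

lemma mnorm_jac_g0:
  assumes "0 < sqn d x"
  shows "(mnorm d (jac (g0 d) x))\<^sup>2 = real d * (1 / sqn d x)\<^sup>2"
proof -
  have "qform d (jac (g0 d) x) x = minner d (\<lambda>i j. x i * x j) (jac (g0 d) x)"
    by (simp add: qform_def minner_def mult.commute)
  \<comment> \<open>The reflection maps x to -x, so this quadratic form must come out as -1.\<close>
  also have "\<dots> = sqn d x * (1 / sqn d x) - 2 * ((sqn d x)\<^sup>2 * (1 / sqn d x)\<^sup>2)"
  proof -
    have "mtrace d (\<lambda>i j. x i * x j) = sqn d x" by (simp add: mtrace_def sqn_def power2_eq_square)
    moreover have "qform d (\<lambda>i j. x i * x j) x = (sqn d x)\<^sup>2"
      by (simp add: qform_def sqn_def power2_eq_square[of "sum _ _"] sum_product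
          power2_eq_square algebra_simps)
    ultimately show ?thesis by (simp only: minner_jac_g0[OF assms])
  qed
  also have "\<dots> = - 1" using assms by (simp add: power_one_over)
  finally show ?thesis
    unfolding mnorm_sq minner_jac_g0[OF assms] mtrace_jac_g0[OF assms]
    by (simp add: power2_eq_square left_diff_distrib diff_divide_distrib)
qed

section \<open>Integrability and moments for a fixed Stein problem\<close>

locale stein_setting = prob_space M for M :: "'a measure" +
  fixes d :: nat and \<sigma>2 :: real and X :: "'a \<Rightarrow> vec" and \<theta> :: vec and T :: "vec \<Rightarrow> mat"
  assumes problem: "stein_problem d \<sigma>2 M X \<theta> T"
begin

definition R :: "'a \<Rightarrow> real" where "R \<omega> = 1 / sqn d (X \<omega>)"

lemma sqn_pos: "AE \<omega> in M. 0 < sqn d (X \<omega>)"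
proof -
  have "AE \<omega> in M. X \<omega> \<noteq> (\<lambda>_. 0)" "\<forall>\<omega>\<in>space M. X \<omega> \<in> Rd d"
    using problem by (auto simp: stein_problem_def)
  then show ?thesis
    by (auto elim!: AE_mp intro!: AE_I2 simp: sqn_eq_0_iff sqn_nonneg less_le)
qed

text \<open>In dimension 0 the only vector is 0, which contradicts X being almost surely
  nonzero.\<close>

lemma d_pos: "0 < d"
proof (rule ccontr)
  assume "\<not> 0 < d"
  then have "AE \<omega> in M. False" using sqn_pos by (simp add: sqn_def)
  then show False by simp
qed

lemma X_square_integrable: "i < d \<Longrightarrow> square_integrable M (\<lambda>\<omega>. X \<omega> i)"
  using problem by (auto simp: stein_problem_def square_integrable_def)

lemma const_square_integrable: "square_integrable M (\<lambda>_. c)"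
  by (simp add: square_integrable_def)

lemma square_integrable_integrable: "square_integrable M f \<Longrightarrow> integrable M f"
  using square_integrable_mult_integrable[OF _ const_square_integrable[of 1], of f] by simp

lemma T_square_integrable:
  assumes "i < d" "j < d" shows "square_integrable M (\<lambda>\<omega>. T (X \<omega>) i j)"
proof -
  have "square_integrable M (\<lambda>\<omega>. T (X \<omega>) i j / real d)"
    using problem assms by (auto simp: stein_problem_def stein_kernel_def square_integrable_def)
  from square_integrable_cmult[OF this, of "real d"] show ?thesis using d_pos by simp
qed

lemma W12_g0: "W12 d M X (g0 d) (jac (g0 d))"
  using problem by (auto simp: stein_problem_def)

lemma g0_square_integrable: "i < d \<Longrightarrow> square_integrable M (\<lambda>\<omega>. g0 d (X \<omega>) i)"
  using W12_g0 by (auto simp: W12_def sob_closure_def square_integrable_def)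

lemma jac_g0_square_integrable:
  "i < d \<Longrightarrow> j < d \<Longrightarrow> square_integrable M (\<lambda>\<omega>. jac (g0 d) (X \<omega>) i j)"
  using W12_g0 by (auto simp: W12_def sob_closure_def square_integrable_def)

lemma sqn_measurable [measurable]: "(\<lambda>\<omega>. sqn d (X \<omega>)) \<in> borel_measurable M"
  unfolding sqn_def
  by (intro borel_measurable_sum borel_measurable_power square_integrable_measurable
      X_square_integrable) auto

lemma R_measurable [measurable]: "R \<in> borel_measurable M"
  unfolding R_def by measurable

text \<open>Finiteness of E|X|^-4 is hidden in the Sobolev condition on \<open>g0\<close>: its
  Jacobian is square-integrable and has squared norm d |X|^-4 almost surely.\<close>

lemma R_square_integrable: "square_integrable M R"
  unfolding square_integrable_def
proof
  have "integrable M (\<lambda>\<omega>. 1 / real d * (mnorm d (jac (g0 d) (X \<omega>)))\<^sup>2)"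
    unfolding mnorm_sq minner_def
    by (intro integrable_mult_right Bochner_Integration.integrable_sum
        square_integrable_mult_integrable jac_g0_square_integrable) auto
  then show "integrable M (\<lambda>\<omega>. (R \<omega>)\<^sup>2)"
  proof (rule integrable_cong_AE_imp)
    show "AE \<omega> in M. 1 / real d * (mnorm d (jac (g0 d) (X \<omega>)))\<^sup>2 = (R \<omega>)\<^sup>2"
      using sqn_pos by eventually_elim (use d_pos in \<open>simp add: mnorm_jac_g0 R_def\<close>)
  qed measurable
qed simp

lemma stein_identity:
  "W12 d M X F G \<Longrightarrow>
    (\<integral>\<omega>. vinner d (\<lambda>i. X \<omega> i - \<theta> i) (F (X \<omega>)) \<partial>M) = (\<integral>\<omega>. minner d (\<lambda>i j. T (X \<omega>) i j / real d) (G (X \<omega>)) \<partial>M)"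
  using problem by (auto simp: stein_problem_def stein_kernel_def)

lemma centred_square_integrable: "i < d \<Longrightarrow> square_integrable M (\<lambda>\<omega>. X \<omega> i - \<theta> i)"
  by (intro square_integrable_diff X_square_integrable const_square_integrable)

lemma centred_mean: "i < d \<Longrightarrow> (\<integral>\<omega>. X \<omega> i - \<theta> i \<partial>M) = 0"
  using problem square_integrable_integrable[OF X_square_integrable]
  by (auto simp: stein_problem_def prob_space)

lemma centred_variance: "i < d \<Longrightarrow> (\<integral>\<omega>. (X \<omega> i - \<theta> i)\<^sup>2 \<partial>M) = \<sigma>2 / real d"
  using problem by (auto simp: stein_problem_def power2_eq_square idm_def)

lemma sigma2_nonneg: "0 \<le> \<sigma>2"
proof -
  have "0 \<le> (\<integral>\<omega>. (X \<omega> 0 - \<theta> 0)\<^sup>2 \<partial>M)" by simp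
  then show ?thesis using centred_variance[OF d_pos] d_pos by (simp add: zero_le_divide_iff)
qed

lemma centred_X_mean: "i < d \<Longrightarrow> (\<integral>\<omega>. (X \<omega> i - \<theta> i) * X \<omega> i \<partial>M) = \<sigma>2 / real d"
proof -
  assume i: "i < d"
  have "(\<integral>\<omega>. (X \<omega> i - \<theta> i) * X \<omega> i \<partial>M) = (\<integral>\<omega>. (X \<omega> i - \<theta> i)\<^sup>2 + \<theta> i * (X \<omega> i - \<theta> i) \<partial>M)"
    by (intro arg_cong[where f = "integral\<^sup>L M"] ext) (simp add: power2_eq_square algebra_simps)
  also have "\<dots> = \<sigma>2 / real d + \<theta> i * 0"
    using centred_square_integrable[OF i] square_integrable_integrable[OF centred_square_integrable[OF i]]
    by (subst Bochner_Integration.integral_add)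
       (simp_all add: square_integrable_def centred_variance i centred_mean del: Bochner_Integration.integral_diff)
  finally show ?thesis by simp
qed

lemma X_second_moment: "i < d \<Longrightarrow> (\<integral>\<omega>. (X \<omega> i)\<^sup>2 \<partial>M) = \<sigma>2 / real d + (\<theta> i)\<^sup>2"
proof -
  assume i: "i < d"
  have "(\<integral>\<omega>. (X \<omega> i)\<^sup>2 \<partial>M) = (\<integral>\<omega>. (X \<omega> i - \<theta> i) * X \<omega> i + \<theta> i * X \<omega> i \<partial>M)"
    by (intro arg_cong[where f = "integral\<^sup>L M"] ext) (simp add: power2_eq_square algebra_simps)
  also have "\<dots> = \<sigma>2 / real d + \<theta> i * \<theta> i"
    using square_integrable_integrable[OF X_square_integrable[OF i]] i problem
    by (subst Bochner_Integration.integral_add)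
       (auto intro!: square_integrable_mult_integrable centred_square_integrable X_square_integrable
         simp: centred_X_mean stein_problem_def)
  finally show ?thesis by (simp add: power2_eq_square)
qed

text \<open>The identity is itself smooth, so the constant sequence approximates it with zero error.
  As a test field it turns the kernel side of Stein's identity into a trace.\<close>

lemma W12_identity: "W12 d M X (\<lambda>x. x) (\<lambda>_. idm)"
  unfolding W12_def sob_closure_def
proof (intro conjI allI impI exI[of _ "\<lambda>_ x. x"])
  have "smooth d (\<lambda>x. x i)" for i
    by (rule cutoff_algebra_smooth[of d 1, OF cutoff_algebra.coord]) simp
  then show "smooth_vec d (\<lambda>x. x)" by (simp add: smooth_vec_def)
  have "jac (\<lambda>x. x) x i j = idm i j" for x i j
    unfolding jac_def pdiff_def
    by (rule DERIV_imp_deriv) (auto simp: idm_def intro!: derivative_eq_intros)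
  then show "(\<lambda>n. \<integral>\<^sup>+\<omega>. ennreal ((mnorm d (\<lambda>i j. idm i j - jac (\<lambda>x. x) (X \<omega>) i j))\<^sup>2) \<partial>M) \<longlonglongrightarrow> 0"
    by (simp add: mnorm_def minner_def)
qed (use X_square_integrable in \<open>auto simp: vnorm_def square_integrable_def\<close>)

lemma mean_trace_T: "(\<integral>\<omega>. mtrace d (T (X \<omega>)) \<partial>M) = real d * \<sigma>2"
proof -
  have "(\<integral>\<omega>. mtrace d (T (X \<omega>)) / real d \<partial>M) = (\<integral>\<omega>. minner d (\<lambda>i j. T (X \<omega>) i j / real d) idm \<partial>M)"
    by (simp only: minner_idm mtrace_def sum_divide_distrib)
  also have "\<dots> = (\<integral>\<omega>. (\<Sum>i<d. (X \<omega> i - \<theta> i) * X \<omega> i) \<partial>M)"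
    using stein_identity[OF W12_identity] by (simp add: vinner_def)
  also have "\<dots> = (\<Sum>i<d. \<integral>\<omega>. (X \<omega> i - \<theta> i) * X \<omega> i \<partial>M)"
    by (intro Bochner_Integration.integral_sum square_integrable_mult_integrable
        centred_square_integrable X_square_integrable) auto
  also have "\<dots> = \<sigma>2" using d_pos by (simp add: centred_X_mean)
  finally show ?thesis using d_pos by (simp add: field_simps)
qed

section \<open>The risk identity and Jensen's inequality\<close>

abbreviation "A \<omega> \<equiv> (\<lambda>i j. T (X \<omega>) i j / real d)"

text \<open>By Stein's identity this is also E<X - theta, g0(X)>, the cross term of the
  risk.\<close>

definition IA :: real where "IA = (\<integral>\<omega>. minner d (A \<omega>) (jac (g0 d) (X \<omega>)) \<partial>M)"

lemma A_square_integrable: "i < d \<Longrightarrow> j < d \<Longrightarrow> square_integrable M (\<lambda>\<omega>. A \<omega> i j)"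
  using square_integrable_cmult[OF T_square_integrable, of i j "1 / real d"] by simp

lemma A_jac_integrable: "integrable M (\<lambda>\<omega>. minner d (A \<omega>) (jac (g0 d) (X \<omega>)))"
  unfolding minner_def
  by (intro Bochner_Integration.integrable_sum square_integrable_mult_integrable
      jac_g0_square_integrable A_square_integrable) auto

lemma R_integrable: "integrable M R"
  by (rule square_integrable_integrable[OF R_square_integrable])

lemma Blam_eq: "Blam d \<sigma>2 M X T = \<bar>lam d \<sigma>2 * (lam d \<sigma>2 * expectation R - IA)\<bar>"
proof -
  let ?D = "\<lambda>\<omega> i j. \<sigma>2 / real d * idm i j - A \<omega> i j"
  have pt: "minner d (?D \<omega>) (jac (\<lambda>x i. - lam d \<sigma>2 * g0 d x i) (X \<omega>))
      = - lam d \<sigma>2 * (lam d \<sigma>2 * R \<omega> - minner d (A \<omega>) (jac (g0 d) (X \<omega>)))" if "0 < sqn d (X \<omega>)" for \<omega>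
  proof -
    have "minner d (?D \<omega>) (jac (g0 d) (X \<omega>))
        = \<sigma>2 / real d * minner d (jac (g0 d) (X \<omega>)) idm - minner d (A \<omega>) (jac (g0 d) (X \<omega>))"
      unfolding minner_def sum_distrib_left sum_subtractf[symmetric]
      by (intro sum.cong refl) (simp add: algebra_simps)
    also have "\<sigma>2 / real d * minner d (jac (g0 d) (X \<omega>)) idm = lam d \<sigma>2 * R \<omega>"
      by (simp only: minner_idm mtrace_jac_g0[OF that] R_def lam_def) (simp add: mult_ac)
    finally show ?thesis by (simp only: minner_jac_scaled_g0[OF that])
  qed
  have "(\<integral>\<omega>. minner d (?D \<omega>) (jac (\<lambda>x i. - lam d \<sigma>2 * g0 d x i) (X \<omega>)) \<partial>M)
      = (\<integral>\<omega>. - lam d \<sigma>2 * (lam d \<sigma>2 * R \<omega> - minner d (A \<omega>) (jac (g0 d) (X \<omega>))) \<partial>M)"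
  proof -
    txt \<open>Off the null event \<open>X = 0\<close> the integrand is a formula in \<open>X\<close>; on it, it is a junk value, but a constant one.\<close>
    have D: "(\<lambda>\<omega>. - lam d \<sigma>2 * (lam d \<sigma>2 * R \<omega> - minner d (A \<omega>) (jac (g0 d) (X \<omega>)))) \<in> borel_measurable M"
      by (intro borel_measurable_times borel_measurable_diff borel_measurable_const R_measurable
          borel_measurable_integrable[OF A_jac_integrable])
    let ?J = "jac (\<lambda>x i. - lam d \<sigma>2 * g0 d x i)"
    have "minner d (?D \<omega>) (?J (X \<omega>)) = (if 0 < sqn d (X \<omega>)
        then - lam d \<sigma>2 * (lam d \<sigma>2 * R \<omega> - minner d (A \<omega>) (jac (g0 d) (X \<omega>)))
        else minner d (\<lambda>i j. \<sigma>2 / real d * idm i j - T (\<lambda>_. 0) i j / real d) (?J (\<lambda>_. 0)))"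
      if "\<omega> \<in> space M" for \<omega>
    proof -
      have "X \<omega> = (\<lambda>_. 0)" if "\<not> 0 < sqn d (X \<omega>)"
        using problem \<open>\<omega> \<in> space M\<close> that sqn_nonneg[of d "X \<omega>"]
        by (auto simp: stein_problem_def sqn_eq_0_iff less_le)
      then show ?thesis using pt by (simp only: split: if_split) simp
    qed
    moreover have "(\<lambda>\<omega>. if 0 < sqn d (X \<omega>)
        then - lam d \<sigma>2 * (lam d \<sigma>2 * R \<omega> - minner d (A \<omega>) (jac (g0 d) (X \<omega>)))
        else minner d (\<lambda>i j. \<sigma>2 / real d * idm i j - T (\<lambda>_. 0) i j / real d) (?J (\<lambda>_. 0))) \<in> borel_measurable M"
      by (intro measurable_If D borel_measurable_const) measurable
    ultimately have "(\<lambda>\<omega>. minner d (?D \<omega>) (?J (X \<omega>))) \<in> borel_measurable M"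
      by (subst measurable_cong)
    moreover have "AE \<omega> in M. minner d (?D \<omega>) (?J (X \<omega>))
        = - lam d \<sigma>2 * (lam d \<sigma>2 * R \<omega> - minner d (A \<omega>) (jac (g0 d) (X \<omega>)))"
      using sqn_pos by (rule AE_mp) (intro AE_I2 impI pt)
    ultimately show ?thesis using D by (intro integral_cong_AE)
  qed
  also have "\<dots> = - lam d \<sigma>2 * (lam d \<sigma>2 * expectation R - IA)"
    unfolding IA_def using R_integrable A_jac_integrable by simp
  finally show ?thesis unfolding Blam_def by (simp add: abs_mult)
qed

text \<open>The square of (X - theta) - c g0(X) is expanded. There is no exceptional set: at X = 0
  the conventions on division by 0 make \<open>g0\<close> and \<open>R\<close> vanish.\<close>

lemma shrink_sq:
  "(vnorm d (\<lambda>i. shrink d c (X \<omega>) i - \<theta> i))\<^sup>2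
   = (\<Sum>i<d. (X \<omega> i - \<theta> i)\<^sup>2) - 2 * c * vinner d (\<lambda>i. X \<omega> i - \<theta> i) (g0 d (X \<omega>)) + c\<^sup>2 * R \<omega>"
proof -
  have "(vnorm d (\<lambda>i. shrink d c (X \<omega>) i - \<theta> i))\<^sup>2 = (\<Sum>i<d. (X \<omega> i - \<theta> i)\<^sup>2
      - 2 * c * ((X \<omega> i - \<theta> i) * g0 d (X \<omega>) i) + c\<^sup>2 * ((X \<omega> i)\<^sup>2 * (1 / sqn d (X \<omega>))\<^sup>2))"
    unfolding vnorm_sq
    by (simp only: sqn_def[of d "\<lambda>i. shrink d c (X \<omega>) i - \<theta> i"])
       (intro sum.cong refl, simp only: shrink_def vnorm_sq g0_eq, simp add: power2_eq_square algebra_simps diff_divide_distrib)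
  also have "\<dots> = (\<Sum>i<d. (X \<omega> i - \<theta> i)\<^sup>2) - 2 * c * vinner d (\<lambda>i. X \<omega> i - \<theta> i) (g0 d (X \<omega>))
      + c\<^sup>2 * (sqn d (X \<omega>) * (1 / sqn d (X \<omega>))\<^sup>2)"
    by (simp only: sum.distrib sum_subtractf vinner_def sqn_def sum_distrib_left sum_distrib_right mult_ac)
  finally show ?thesis by (simp only: sqn_mult_recip_sq R_def)
qed

lemma sqn_mean: "integrable M (\<lambda>\<omega>. sqn d (X \<omega>))"
  "expectation (\<lambda>\<omega>. sqn d (X \<omega>)) = (vnorm d \<theta>)\<^sup>2 + \<sigma>2"
proof -
  have i: "integrable M (\<lambda>\<omega>. (X \<omega> i)\<^sup>2)" if "i < d" for i
    using X_square_integrable[OF that] by (simp add: square_integrable_def)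
  show "integrable M (\<lambda>\<omega>. sqn d (X \<omega>))" unfolding sqn_def
    by (intro Bochner_Integration.integrable_sum i) auto
  have "expectation (\<lambda>\<omega>. sqn d (X \<omega>)) = (\<Sum>i<d. expectation (\<lambda>\<omega>. (X \<omega> i)\<^sup>2))"
    unfolding sqn_def by (intro Bochner_Integration.integral_sum i) auto
  also have "\<dots> = \<sigma>2 + sqn d \<theta>"
    using d_pos by (simp add: X_second_moment sum.distrib sqn_def)
  finally show "expectation (\<lambda>\<omega>. sqn d (X \<omega>)) = (vnorm d \<theta>)\<^sup>2 + \<sigma>2" by (simp add: vnorm_sq)
qed

lemma R_mean_ge: "1 / ((vnorm d \<theta>)\<^sup>2 + \<sigma>2) \<le> expectation R"
proof -
  define m where "m = (vnorm d \<theta>)\<^sup>2 + \<sigma>2"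
  show ?thesis
  proof (cases "m = 0")
    \<comment> \<open>Here 1/0 = 0, so nonnegativity of \<open>R\<close> is enough.\<close>
    case True
    then show ?thesis by (simp add: m_def R_def sqn_nonneg)
  next
    case False
    \<comment> \<open>The left side is the tangent to 1/s at s = m, which lies below this convex
      function. Since m is the mean of |X|^2, integrating the tangent gives 1/m.\<close>
    have "2 / m - s / m\<^sup>2 \<le> 1 / s" if "0 < s" for s
    proof -
      have "0 \<le> (m - s)\<^sup>2 / (s * m\<^sup>2)" using that by simp
      also have "\<dots> = 1 / s - (2 / m - s / m\<^sup>2)"
        using that False by (simp add: field_simps power2_eq_square)
      finally show ?thesis by simp
    qed
    then have "AE \<omega> in M. 2 / m - sqn d (X \<omega>) / m\<^sup>2 \<le> R \<omega>"
      using sqn_pos by (auto simp: R_def)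
    then have "expectation (\<lambda>\<omega>. 2 / m - sqn d (X \<omega>) / m\<^sup>2) \<le> expectation R"
      by (intro integral_mono_AE R_integrable) (simp add: sqn_mean)
    moreover have "expectation (\<lambda>\<omega>. 2 / m - sqn d (X \<omega>) / m\<^sup>2) = 1 / m"
      using sqn_mean[folded m_def] False by (simp add: prob_space) (simp add: power2_eq_square)
    ultimately show ?thesis by (simp add: m_def)
  qed
qed

lemma shrink_risk:
  shows "integrable M (\<lambda>\<omega>. (vnorm d (\<lambda>i. shrink d (lam d \<sigma>2) (X \<omega>) i - \<theta> i))\<^sup>2)" (is ?int)
    and "(\<integral>\<omega>. (vnorm d (\<lambda>i. shrink d (lam d \<sigma>2) (X \<omega>) i - \<theta> i))\<^sup>2 \<partial>M)
      \<le> real d * (\<sigma>2 / real d)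
         - (real d - 2)\<^sup>2 * (\<sigma>2 / real d)\<^sup>2 / ((vnorm d \<theta>)\<^sup>2 + real d * (\<sigma>2 / real d))
         + 2 * Blam d \<sigma>2 M X T" (is "?risk \<le> ?bound")
proof -
  let ?l = "lam d \<sigma>2"
  have c: "integrable M (\<lambda>\<omega>. \<Sum>i<d. (X \<omega> i - \<theta> i)\<^sup>2)"
    by (intro Bochner_Integration.integrable_sum)
       (use centred_square_integrable in \<open>auto simp: square_integrable_def\<close>)
  have v: "integrable M (\<lambda>\<omega>. vinner d (\<lambda>i. X \<omega> i - \<theta> i) (g0 d (X \<omega>)))"
    unfolding vinner_def
    by (intro Bochner_Integration.integrable_sum square_integrable_mult_integrable
        centred_square_integrable g0_square_integrable) auto
  show ?int unfolding shrink_sq using c v R_integrable by simp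
  have "expectation (\<lambda>\<omega>. \<Sum>i<d. (X \<omega> i - \<theta> i)\<^sup>2) = (\<Sum>i<d. expectation (\<lambda>\<omega>. (X \<omega> i - \<theta> i)\<^sup>2))"
    by (intro Bochner_Integration.integral_sum)
       (use centred_square_integrable in \<open>auto simp: square_integrable_def\<close>)
  also have "\<dots> = \<sigma>2" using d_pos by (simp add: centred_variance)
  finally have "?risk = \<sigma>2 - 2 * ?l * IA + ?l\<^sup>2 * expectation R"
    unfolding shrink_sq using c v R_integrable stein_identity[OF W12_g0] by (simp add: IA_def)
  \<comment> \<open>The bracket isolates the deviation from the Gaussian case: it vanishes when T =
    sigma^2 Id, and \<open>Blam\<close> is the absolute value of lam times it.\<close>
  also have "\<dots> = \<sigma>2 - ?l\<^sup>2 * expectation R + 2 * (?l * (?l * expectation R - IA))"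
    by (simp add: power2_eq_square algebra_simps)
  also have "\<dots> \<le> \<sigma>2 - ?l\<^sup>2 * (1 / ((vnorm d \<theta>)\<^sup>2 + \<sigma>2)) + 2 * Blam d \<sigma>2 M X T"
    unfolding Blam_eq by (intro add_mono diff_mono mult_left_mono R_mean_ge) auto
  also have "\<dots> = ?bound" using d_pos by (simp add: lam_def power_mult_distrib power_divide)
  finally show "?risk \<le> ?bound" .
qed

section \<open>Bounding the kernel error by trace and matrix fluctuations\<close>

definition trace_variance :: real where
  "trace_variance = (\<integral>\<omega>. (mtrace d (T (X \<omega>)) - (\<integral>\<omega>'. mtrace d (T (X \<omega>')) \<partial>M))\<^sup>2 \<partial>M)"

definition kernel_defect :: real where
  "kernel_defect = (\<integral>\<omega>. (mnorm d (\<lambda>i j. T (X \<omega>) i j - \<sigma>2 * idm i j))\<^sup>2 \<partial>M)"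

abbreviation "D \<omega> \<equiv> (\<lambda>i j. T (X \<omega>) i j - \<sigma>2 * idm i j)"

lemma D_square_integrable: "i < d \<Longrightarrow> j < d \<Longrightarrow> square_integrable M (\<lambda>\<omega>. D \<omega> i j)"
  by (intro square_integrable_diff T_square_integrable const_square_integrable)

text \<open>The mean of Tr T is the trace of sigma^2 Id, so subtracting sigma^2 Id from T centres
  the trace exactly; its second moment is then a variance.\<close>

lemma mtrace_D: "mtrace d (D \<omega>) = mtrace d (T (X \<omega>)) - (\<integral>\<omega>'. mtrace d (T (X \<omega>')) \<partial>M)"
  unfolding mean_trace_T by (simp add: mtrace_def sum_subtractf idm_def)

lemma mtrace_square_integrable:
  "square_integrable M (\<lambda>\<omega>. mtrace d (T (X \<omega>)))" "square_integrable M (\<lambda>\<omega>. mtrace d (D \<omega>))"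
  unfolding mtrace_def
  by (intro square_integrable_sum T_square_integrable D_square_integrable; simp)+

lemma mtrace_D_mean: "(\<integral>\<omega>. mtrace d (D \<omega>) \<partial>M) = 0"
  unfolding mtrace_D
  using square_integrable_integrable[OF mtrace_square_integrable(1)] by (simp add: prob_space)

lemma mnorm_D_square_integrable: "square_integrable M (\<lambda>\<omega>. mnorm d (D \<omega>))"
proof -
  have i: "integrable M (\<lambda>\<omega>. minner d (D \<omega>) (D \<omega>))"
    unfolding minner_def
    by (intro Bochner_Integration.integrable_sum square_integrable_mult_integrable D_square_integrable) auto
  have "(\<lambda>\<omega>. sqrt (minner d (D \<omega>) (D \<omega>))) \<in> borel_measurable M"
    by (rule measurable_compose[OF borel_measurable_integrable[OF i] borel_measurable_sqrt])
  then show ?thesis using i by (simp only: square_integrable_def mnorm_sq) (simp only: mnorm_def)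
qed

lemma Blam_le:
  "Blam d \<sigma>2 M X T \<le> \<sigma>2 / real d *
    (sqrt trace_variance * sqrt (variance R) + 2 * (sqrt kernel_defect * sqrt (expectation (\<lambda>\<omega>. (R \<omega>)\<^sup>2))))"
proof -
  let ?t = "\<lambda>\<omega>. mtrace d (D \<omega>)" and ?q = "\<lambda>\<omega>. qform d (D \<omega>) (X \<omega>) * (R \<omega>)\<^sup>2"
  let ?J = "\<lambda>\<omega>. minner d (D \<omega>) (jac (g0 d) (X \<omega>))"
  have J_int: "integrable M ?J"
    unfolding minner_def
    by (intro Bochner_Integration.integrable_sum square_integrable_mult_integrable
        jac_g0_square_integrable D_square_integrable) auto
  have t_int: "integrable M (\<lambda>\<omega>. ?t \<omega> * R \<omega>)"
    by (rule square_integrable_mult_integrable[OF mtrace_square_integrable(2) R_square_integrable])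
  have J_eq: "AE \<omega> in M. ?J \<omega> = ?t \<omega> * R \<omega> - 2 * ?q \<omega>"
    using sqn_pos by eventually_elim (simp only: minner_jac_g0 R_def)
  have q_meas: "?q \<in> borel_measurable M"
    unfolding qform_def
    by (intro borel_measurable_times borel_measurable_sum borel_measurable_power R_measurable
        square_integrable_measurable D_square_integrable X_square_integrable) auto
  have q_bound: "AE \<omega> in M. \<bar>?q \<omega>\<bar> \<le> mnorm d (D \<omega>) * R \<omega>"
  proof (rule AE_I2)
    fix \<omega>
    have "\<bar>?q \<omega>\<bar> \<le> mnorm d (D \<omega>) * sqn d (X \<omega>) * (R \<omega>)\<^sup>2"
      unfolding abs_mult using abs_qform_le[of d "D \<omega>" "X \<omega>"] by (simp add: mult_right_mono)
    then show "\<bar>?q \<omega>\<bar> \<le> mnorm d (D \<omega>) * R \<omega>"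
      by (simp only: R_def mult.assoc sqn_mult_recip_sq)
  qed
  have m_int: "integrable M (\<lambda>\<omega>. mnorm d (D \<omega>) * R \<omega>)"
    by (rule square_integrable_mult_integrable[OF mnorm_D_square_integrable R_square_integrable])
  have q_int: "integrable M ?q"
    by (rule Bochner_Integration.integrable_bound[OF m_int q_meas]) (use q_bound in \<open>auto elim!: AE_mp\<close>)
  \<comment> \<open>Since \<open>?t\<close> has mean 0, the constant E R may be subtracted from
    \<open>R\<close>. This is what brings in the variance of \<open>R\<close> in place of its second
    moment.\<close>
  have "expectation (\<lambda>\<omega>. ?t \<omega> * R \<omega>) = expectation (\<lambda>\<omega>. ?t \<omega> * (R \<omega> - expectation R))"
    using t_int square_integrable_integrable[OF mtrace_square_integrable(2)] mtrace_D_mean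
    by (simp add: right_diff_distrib)
  then have "\<bar>expectation (\<lambda>\<omega>. ?t \<omega> * R \<omega>)\<bar> \<le> sqrt trace_variance * sqrt (variance R)"
    using Cauchy_Schwarz_integral[OF mtrace_square_integrable(2)
        square_integrable_diff[OF R_square_integrable const_square_integrable], of "expectation R"]
    by (simp only: trace_variance_def mtrace_D)
  moreover have "\<bar>expectation ?q\<bar> \<le> sqrt kernel_defect * sqrt (expectation (\<lambda>\<omega>. (R \<omega>)\<^sup>2))"
  proof -
    have "\<bar>expectation ?q\<bar> \<le> expectation (\<lambda>\<omega>. \<bar>?q \<omega>\<bar>)" by (rule integral_abs_bound)
    also have "\<dots> \<le> expectation (\<lambda>\<omega>. mnorm d (D \<omega>) * R \<omega>)"
      by (intro integral_mono_AE m_int q_bound integrable_abs q_int)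
    also have "\<dots> \<le> sqrt kernel_defect * sqrt (expectation (\<lambda>\<omega>. (R \<omega>)\<^sup>2))"
      using Cauchy_Schwarz_integral[OF mnorm_D_square_integrable R_square_integrable]
      by (simp add: kernel_defect_def)
    finally show ?thesis .
  qed
  moreover have J_exp: "expectation ?J = expectation (\<lambda>\<omega>. ?t \<omega> * R \<omega>) - 2 * expectation ?q"
  proof -
    have "expectation ?J = expectation (\<lambda>\<omega>. ?t \<omega> * R \<omega> - 2 * ?q \<omega>)"
      using J_eq by (intro integral_cong_AE borel_measurable_integrable J_int
          Bochner_Integration.integrable_diff t_int integrable_mult_right q_int)
    then show ?thesis using t_int q_int by simp
  qed
  ultimately have J_le: "\<bar>expectation ?J\<bar> \<le> sqrt trace_variance * sqrt (variance R)
      + 2 * (sqrt kernel_defect * sqrt (expectation (\<lambda>\<omega>. (R \<omega>)\<^sup>2)))"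
    by linarith
  \<comment> \<open>Up to the factor -d this is the bracket in \<open>Blam_eq\<close>; the factor d
    arises because the kernel is T/d.\<close>
  have "expectation ?J = real d * (IA - lam d \<sigma>2 * expectation R)"
  proof -
    have "AE \<omega> in M. ?J \<omega> = real d * minner d (A \<omega>) (jac (g0 d) (X \<omega>)) - real d * (lam d \<sigma>2 * R \<omega>)"
      using sqn_pos
    proof eventually_elim
      case (elim \<omega>)
      have "?J \<omega> = real d * minner d (A \<omega>) (jac (g0 d) (X \<omega>)) - \<sigma>2 * minner d (jac (g0 d) (X \<omega>)) idm"
        unfolding minner_def sum_distrib_left sum_subtractf[symmetric]
        by (intro sum.cong refl) (use d_pos in \<open>simp add: algebra_simps\<close>)
      also have "\<sigma>2 * minner d (jac (g0 d) (X \<omega>)) idm = real d * (lam d \<sigma>2 * R \<omega>)"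
        by (simp only: minner_idm mtrace_jac_g0[OF elim] R_def lam_def) (use d_pos in simp)
      finally show ?case .
    qed
    then have "expectation ?J
        = expectation (\<lambda>\<omega>. real d * minner d (A \<omega>) (jac (g0 d) (X \<omega>)) - real d * (lam d \<sigma>2 * R \<omega>))"
      by (intro integral_cong_AE borel_measurable_integrable J_int
          Bochner_Integration.integrable_diff integrable_mult_right R_integrable A_jac_integrable)
    then show ?thesis using R_integrable A_jac_integrable
      by (simp add: IA_def right_diff_distrib)
  qed
  then have "\<bar>lam d \<sigma>2 * expectation R - IA\<bar> = 1 / real d * \<bar>expectation ?J\<bar>"
    using d_pos by (simp add: abs_mult abs_minus_commute)
  moreover have "\<bar>lam d \<sigma>2\<bar> \<le> \<sigma>2"
  proof -
    \<comment> \<open>This includes d = 1, where d - 2 = -1 and equality holds.\<close>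
    have "\<bar>real d - 2\<bar> / real d \<le> 1" using d_pos by simp
    then have "\<bar>real d - 2\<bar> / real d * \<sigma>2 \<le> 1 * \<sigma>2" by (intro mult_right_mono sigma2_nonneg)
    then show ?thesis using sigma2_nonneg by (simp add: lam_def abs_mult)
  qed
  ultimately have "Blam d \<sigma>2 M X T \<le> \<sigma>2 * (1 / real d * \<bar>expectation ?J\<bar>)"
    unfolding Blam_eq abs_mult by (simp only:) (intro mult_right_mono, auto)
  also have "\<dots> \<le> \<sigma>2 * (1 / real d * (sqrt trace_variance * sqrt (variance R)
      + 2 * (sqrt kernel_defect * sqrt (expectation (\<lambda>\<omega>. (R \<omega>)\<^sup>2)))))"
    by (intro mult_left_mono J_le sigma2_nonneg) auto
  finally show ?thesis by simp
qed

lemma variance_R_le: "variance R \<le> expectation (\<lambda>\<omega>. (R \<omega>)\<^sup>2)"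
  using R_square_integrable R_integrable by (simp add: variance_eq square_integrable_def)

lemma trace_variance_le: "trace_variance \<le> real d * kernel_defect"
proof -
  have "trace_variance = (\<integral>\<omega>. (mtrace d (D \<omega>))\<^sup>2 \<partial>M)"
    by (simp only: trace_variance_def mtrace_D)
  also have "\<dots> \<le> (\<integral>\<omega>. real d * (mnorm d (D \<omega>))\<^sup>2 \<partial>M)"
    using mtrace_square_integrable(2) mnorm_D_square_integrable
    by (intro integral_mono mtrace_sq_le) (auto simp: square_integrable_def)
  finally show ?thesis by (simp add: kernel_defect_def)
qed

text \<open>Pythagoras: E Tr T = d sigma^2 says that T - sigma^2 Id is orthogonal to Id in mean, so
  E|T|^2 exceeds the defect by sigma^4 d.\<close>

lemma kernel_defect_le: "kernel_defect \<le> (\<integral>\<omega>. (mnorm d (T (X \<omega>)))\<^sup>2 \<partial>M)"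
proof -
  have i: "integrable M (\<lambda>\<omega>. minner d (T (X \<omega>)) (T (X \<omega>)))"
    unfolding minner_def
    by (intro Bochner_Integration.integrable_sum square_integrable_mult_integrable T_square_integrable) auto
  have "minner d (D \<omega>) (D \<omega>)
      = minner d (T (X \<omega>)) (T (X \<omega>)) - 2 * \<sigma>2 * minner d (T (X \<omega>)) idm + \<sigma>2\<^sup>2 * minner d idm idm" for \<omega>
    unfolding minner_def sum_distrib_left sum_subtractf[symmetric] sum.distrib[symmetric]
    by (intro sum.cong refl) (simp add: power2_eq_square algebra_simps)
  moreover have "minner d idm idm = real d" unfolding minner_idm by (simp add: mtrace_def idm_def)
  ultimately have "kernel_defect = (\<integral>\<omega>. minner d (T (X \<omega>)) (T (X \<omega>)) - 2 * \<sigma>2 * mtrace d (T (X \<omega>)) + \<sigma>2\<^sup>2 * real d \<partial>M)"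
    by (simp only: kernel_defect_def mnorm_sq minner_idm)
  also have "\<dots> = (\<integral>\<omega>. minner d (T (X \<omega>)) (T (X \<omega>)) \<partial>M) - \<sigma>2\<^sup>2 * real d"
    using i square_integrable_integrable[OF mtrace_square_integrable(1)]
    by (simp add: mean_trace_T prob_space power2_eq_square)
  finally show ?thesis by (simp add: mnorm_sq)
qed

section \<open>The variance of |X|^-2 under a Poincare inequality\<close>

text \<open>The factor 1/d is a matter of scaling: with Z = sqrt(d) X the variance of |Z|^-2 is that
  of |X|^-2 divided by d^2, whereas |Z|^-6 in the gradient bound is |X|^-6 divided by d^3.\<close>

lemma variance_R_poincare:
  assumes "poincare d M (\<lambda>\<omega> i. sqrt (real d) * X \<omega> i) C"
    and int6: "integrable M (\<lambda>\<omega>. 1 / (vnorm d (X \<omega>)) ^ 6)"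
  shows "variance R \<le> 4 * (2 * exp 1 + 1)\<^sup>2 * \<bar>C\<bar> / real d * (\<integral>\<omega>. 1 / (vnorm d (X \<omega>)) ^ 6 \<partial>M)"
proof -
  define K :: real where "K = 4 * (2 * exp 1 + 1)\<^sup>2"
  define Z where "Z \<omega> = (\<lambda>i. sqrt (real d) * X \<omega> i)" for \<omega>
  define F where "F n \<omega> = trunc_recip d (real (Suc n)) (Z \<omega>)" for n \<omega>
  have sqn_Z: "sqn d (Z \<omega>) = real d * sqn d (X \<omega>)" for \<omega>
    by (simp add: sqn_def Z_def power_mult_distrib sum_distrib_left)
  have recip_Z: "1 / sqn d (Z \<omega>) = 1 / real d * R \<omega>" for \<omega> by (simp add: sqn_Z R_def)
  have Z_pos: "AE \<omega> in M. 0 < sqn d (Z \<omega>)"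
    using sqn_pos by eventually_elim (use d_pos in \<open>simp add: sqn_Z\<close>)
  have "continuous_on UNIV (flat 0)"
    using flat_has_derivative DERIV_continuous by (blast intro: continuous_at_imp_continuous_on)
  then have [measurable]: "flat 0 \<in> borel_measurable borel" by (rule borel_measurable_continuous_onI)
  have F_meas [measurable]: "F n \<in> borel_measurable M" for n
    unfolding F_def trunc_recip_def sqn_Z by measurable
  have F_bound: "AE \<omega> in M. norm (F n \<omega>) \<le> 1 / real d * R \<omega>" for n
    using Z_pos
  proof eventually_elim
    case (elim \<omega>)
    show ?case using trunc_recip_bounds[of "real (Suc n)", OF _ elim]
      unfolding F_def recip_Z[symmetric] by (simp del: of_nat_Suc)
  qed
  have F_sq_bound: "AE \<omega> in M. norm ((F n \<omega>)\<^sup>2) \<le> (1 / real d * R \<omega>)\<^sup>2" for n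
    using F_bound[of n] by eventually_elim (simp add: abs_le_square_iff[symmetric] R_def sqn_nonneg)
  have F_lim: "AE \<omega> in M. (\<lambda>n. F n \<omega>) \<longlonglongrightarrow> 1 / real d * R \<omega>"
    using Z_pos by eventually_elim (simp only: F_def recip_Z[symmetric] trunc_recip_tendsto)
  have w1: "integrable M (\<lambda>\<omega>. 1 / real d * R \<omega>)" and w2: "integrable M (\<lambda>\<omega>. (1 / real d * R \<omega>)\<^sup>2)"
    using R_integrable square_integrable_cmult[OF R_square_integrable, of "1 / real d"]
    by (auto simp: square_integrable_def)
  have F_int: "integrable M (F n)" for n
  proof (rule Bochner_Integration.integrable_bound[OF w1 F_meas])
    show "AE \<omega> in M. norm (F n \<omega>) \<le> norm (1 / real d * R \<omega>)"
      using F_bound[of n] by eventually_elim (erule order_trans, simp only: real_norm_def abs_ge_self)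
  qed
  have F_sq_int: "integrable M (\<lambda>\<omega>. (F n \<omega>)\<^sup>2)" for n
  proof (rule Bochner_Integration.integrable_bound[OF w2])
    show "AE \<omega> in M. norm ((F n \<omega>)\<^sup>2) \<le> norm ((1 / real d * R \<omega>)\<^sup>2)"
      using F_sq_bound[of n] by eventually_elim simp
  qed measurable
  have "(\<lambda>n. expectation (F n)) \<longlonglongrightarrow> expectation (\<lambda>\<omega>. 1 / real d * R \<omega>)"
    by (rule integral_dominated_convergence[OF _ _ w1 F_lim F_bound]) measurable
  moreover have "(\<lambda>n. expectation (\<lambda>\<omega>. (F n \<omega>)\<^sup>2)) \<longlonglongrightarrow> expectation (\<lambda>\<omega>. (1 / real d * R \<omega>)\<^sup>2)"
  proof (rule integral_dominated_convergence[OF _ _ w2 _ F_sq_bound])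
    show "AE \<omega> in M. (\<lambda>n. (F n \<omega>)\<^sup>2) \<longlonglongrightarrow> (1 / real d * R \<omega>)\<^sup>2"
      using F_lim by eventually_elim (rule tendsto_power)
  qed measurable
  ultimately have "(\<lambda>n. expectation (\<lambda>\<omega>. (F n \<omega>)\<^sup>2) - (expectation (F n))\<^sup>2)
      \<longlonglongrightarrow> expectation (\<lambda>\<omega>. (1 / real d * R \<omega>)\<^sup>2) - (expectation (\<lambda>\<omega>. 1 / real d * R \<omega>))\<^sup>2"
    by (intro tendsto_intros)
  also have "expectation (\<lambda>\<omega>. (1 / real d * R \<omega>)\<^sup>2) - (expectation (\<lambda>\<omega>. 1 / real d * R \<omega>))\<^sup>2
      = 1 / (real d)\<^sup>2 * variance R"
    using R_square_integrable R_integrable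
    by (simp add: variance_eq square_integrable_def power_divide diff_divide_distrib)
  finally have lim: "(\<lambda>n. expectation (\<lambda>\<omega>. (F n \<omega>)\<^sup>2) - (expectation (F n))\<^sup>2)
      \<longlonglongrightarrow> 1 / (real d)\<^sup>2 * variance R" .
  have norm6: "1 / (vnorm d x) ^ 6 = (1 / sqn d x) ^ 3" for x
  proof -
    have "(vnorm d x) ^ 6 = ((vnorm d x)\<^sup>2) ^ 3" by (simp add: power_mult[symmetric])
    then show ?thesis by (simp add: vnorm_sq power_one_over)
  qed
  have "expectation (\<lambda>\<omega>. (F n \<omega>)\<^sup>2) - (expectation (F n))\<^sup>2
      \<le> \<bar>C\<bar> * (K / (real d) ^ 3 * (\<integral>\<omega>. 1 / (vnorm d (X \<omega>)) ^ 6 \<partial>M))" for n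
  proof -
    let ?g = "\<lambda>\<omega>. (vnorm d (grad (trunc_recip d (real (Suc n))) (Z \<omega>)))\<^sup>2"
    have "expectation (\<lambda>\<omega>. (F n \<omega>)\<^sup>2) - (expectation (F n))\<^sup>2 = variance (F n)"
      using F_int F_sq_int by (simp add: variance_eq)
    also have "\<dots> \<le> C * expectation ?g"
      using assms(1) Cc_inf_trunc_recip[of "real (Suc n)" d]
      unfolding poincare_def Z_def[symmetric] F_def by simp
    \<comment> \<open>The sign of \<open>C\<close> is not fixed by \<open>poincare\<close>; with |C|
      the gradient term can be replaced by an upper bound.\<close>
    also have "\<dots> \<le> \<bar>C\<bar> * expectation ?g" by (intro mult_right_mono) auto
    \<comment> \<open>An integrable nonnegative majorant suffices: if the squared gradient were not
      integrable, its integral would be 0 by convention.\<close>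
    also have "expectation ?g \<le> expectation (\<lambda>\<omega>. K / (real d) ^ 3 * (1 / (vnorm d (X \<omega>)) ^ 6))"
    proof (rule integral_mono_AE')
      show "integrable M (\<lambda>\<omega>. K / (real d) ^ 3 * (1 / (vnorm d (X \<omega>)) ^ 6))"
        by (intro integrable_mult_right int6)
      show "AE \<omega> in M. ?g \<omega> \<le> K / (real d) ^ 3 * (1 / (vnorm d (X \<omega>)) ^ 6)"
        using Z_pos
      proof eventually_elim
        case (elim \<omega>)
        have "?g \<omega> \<le> K * (1 / sqn d (Z \<omega>)) ^ 3"
          unfolding K_def by (rule grad_trunc_recip_le[OF _ elim]) simp
        then show ?case by (simp add: norm6 sqn_Z power_mult_distrib power_one_over power_divide)
      qed
      show "AE \<omega> in M. 0 \<le> K / (real d) ^ 3 * (1 / (vnorm d (X \<omega>)) ^ 6)"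
        by (simp add: K_def vnorm_sqn sqn_nonneg)
    qed
    finally show ?thesis by (simp only: integral_mult_right_zero abs_ge_zero mult_left_mono)
  qed
  then have "1 / (real d)\<^sup>2 * variance R \<le> \<bar>C\<bar> * (K / (real d) ^ 3 * (\<integral>\<omega>. 1 / (vnorm d (X \<omega>)) ^ 6 \<partial>M))"
    by (intro LIMSEQ_le_const2[OF lim]) auto
  then have "(real d)\<^sup>2 * (1 / (real d)\<^sup>2 * variance R)
      \<le> (real d)\<^sup>2 * (\<bar>C\<bar> * (K / (real d) ^ 3 * (\<integral>\<omega>. 1 / (vnorm d (X \<omega>)) ^ 6 \<partial>M)))"
    by (rule mult_left_mono) simp
  then show ?thesis unfolding K_def[symmetric]
    using d_pos by (simp add: power3_eq_cube power2_eq_square mult_ac)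
qed

section \<open>Explicit bounds under the two conditions\<close>

lemma R_sq_eq: "(R \<omega>)\<^sup>2 = 1 / (vnorm d (X \<omega>)) ^ 4"
proof -
  have "(vnorm d (X \<omega>)) ^ 4 = ((vnorm d (X \<omega>))\<^sup>2)\<^sup>2" by (simp add: power_mult[symmetric])
  then show ?thesis by (simp add: vnorm_sq R_def power_one_over)
qed

lemma trace_variance_nonneg: "0 \<le> trace_variance"
  by (simp add: trace_variance_def)

lemma kernel_defect_nonneg: "0 \<le> kernel_defect"
  by (simp add: kernel_defect_def)

text \<open>Both factors involving \<open>R\<close> are at most sqrt C, because a variance is at
  most a second moment. The prefactor 1/d goes under the roots as 1/d^2, the normalisation in which
  (a) is stated.\<close>

lemma Blam_le_fourth_moment:
  assumes "(\<integral>\<omega>. 1 / (vnorm d (X \<omega>)) ^ 4 \<partial>M) \<le> C"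
  shows "Blam d \<sigma>2 M X T \<le> \<sigma>2 * sqrt C *
    (sqrt (trace_variance / (real d)\<^sup>2) + 2 * sqrt (kernel_defect / (real d)\<^sup>2))"
proof -
  have Q: "sqrt (expectation (\<lambda>\<omega>. (R \<omega>)\<^sup>2)) \<le> sqrt C" using assms by (simp add: R_sq_eq)
  have W: "sqrt (variance R) \<le> sqrt C" using variance_R_le Q real_sqrt_le_mono order_trans by blast
  have "Blam d \<sigma>2 M X T \<le> \<sigma>2 / real d *
      (sqrt trace_variance * sqrt C + 2 * (sqrt kernel_defect * sqrt C))"
    using sigma2_nonneg trace_variance_nonneg kernel_defect_nonneg
    by (intro order_trans[OF Blam_le] mult_left_mono add_mono Q W) auto
  also have "\<dots> = \<sigma>2 * sqrt C * (sqrt (trace_variance / (real d)\<^sup>2) + 2 * sqrt (kernel_defect / (real d)\<^sup>2))"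
    using d_pos by (simp add: real_sqrt_divide field_simps)
  finally show ?thesis .
qed

text \<open>For fixed sigma^2 and c, the trace term has order |C| / sqrt(d) after division by d, and
  the matrix term sqrt(|C| / d). The latter is weakened so that both are expressed through the
  single quantity |C| / sqrt(d).\<close>

lemma Blam_le_poincare:
  assumes P: "poincare d M (\<lambda>\<omega> i. sqrt (real d) * X \<omega> i) C"
    and T: "(\<integral>\<omega>. (mnorm d (T (X \<omega>)))\<^sup>2 \<partial>M) \<le> C * \<sigma>2 * real d"
    and int6: "integrable M (\<lambda>\<omega>. 1 / (vnorm d (X \<omega>)) ^ 6)"
    and E6: "(\<integral>\<omega>. 1 / (vnorm d (X \<omega>)) ^ 6 \<partial>M) \<le> c"
  shows "Blam d \<sigma>2 M X T \<le> \<sigma>2 *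
    (sqrt (\<sigma>2 * (4 * (2 * exp 1 + 1)\<^sup>2) * c) * (\<bar>C\<bar> / sqrt (real d))
      + 2 * (sqrt (\<sigma>2 * (1 + c)) * sqrt (\<bar>C\<bar> / sqrt (real d))))"
proof -
  define K :: real where "K = 4 * (2 * exp 1 + 1)\<^sup>2"
  have K: "0 \<le> K" by (simp add: K_def)
  have "0 \<le> (\<integral>\<omega>. 1 / (vnorm d (X \<omega>)) ^ 6 \<partial>M)" by simp
  then have c: "0 \<le> c" using E6 by linarith
  have d1: "1 \<le> real d" "0 < real d" using d_pos by auto
  have N: "kernel_defect \<le> \<bar>C\<bar> * \<sigma>2 * real d"
  proof -
    have "C * \<sigma>2 * real d \<le> \<bar>C\<bar> * \<sigma>2 * real d" using sigma2_nonneg by (intro mult_right_mono) auto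
    then show ?thesis using kernel_defect_le T by linarith
  qed
  have V: "trace_variance \<le> real d * (\<bar>C\<bar> * \<sigma>2 * real d)"
    using trace_variance_le N mult_left_mono[OF N, of "real d"] by simp
  have W: "variance R \<le> K * \<bar>C\<bar> / real d * c"
    unfolding K_def
    by (rule order_trans[OF variance_R_poincare[OF P int6]]) (intro mult_left_mono E6, simp)
  have "expectation (\<lambda>\<omega>. (R \<omega>)\<^sup>2) \<le> expectation (\<lambda>\<omega>. 1 + 1 / (vnorm d (X \<omega>)) ^ 6)"
  proof (rule integral_mono)
    fix \<omega>
    \<comment> \<open>The fourth inverse moment is controlled by the sixth, splitting at y =
      1.\<close>
    have "y ^ 4 \<le> 1 + y ^ 6" if "0 \<le> y" for y :: real
    proof (cases "y \<le> 1")
      case True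
      then have "y ^ 4 \<le> 1" using that by (simp add: power_le_one)
      then show ?thesis using that by (simp add: add_increasing2)
    next
      case False
      then have "y ^ 4 \<le> y ^ 6" by (intro power_increasing) auto
      then show ?thesis by simp
    qed
    from this[of "1 / vnorm d (X \<omega>)"] show "(R \<omega>)\<^sup>2 \<le> 1 + 1 / (vnorm d (X \<omega>)) ^ 6"
      by (simp add: R_sq_eq power_one_over vnorm_sqn sqn_nonneg)
  qed (use R_square_integrable int6 in \<open>auto simp: square_integrable_def\<close>)
  also have "\<dots> \<le> 1 + c" using int6 E6 by (simp add: prob_space)
  finally have Q: "expectation (\<lambda>\<omega>. (R \<omega>)\<^sup>2) \<le> 1 + c" .
  have "sqrt trace_variance * sqrt (variance R)
      \<le> sqrt (real d * (\<bar>C\<bar> * \<sigma>2 * real d)) * sqrt (K * \<bar>C\<bar> / real d * c)"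
    by (intro mult_mono real_sqrt_le_mono V W) (use sigma2_nonneg in auto)
  also have "\<dots> = sqrt ((\<sigma>2 * K * c) * (\<bar>C\<bar>\<^sup>2 * real d))"
    unfolding real_sqrt_mult[symmetric]
    using d1 by (intro arg_cong[where f = sqrt]) (simp add: power2_eq_square)
  also have "\<dots> = real d * (sqrt (\<sigma>2 * K * c) * (\<bar>C\<bar> / sqrt (real d)))"
  proof -
    have "sqrt (\<bar>C\<bar>\<^sup>2 * real d) = real d * (\<bar>C\<bar> / sqrt (real d))"
      using d1 by (simp add: real_sqrt_mult field_simps)
    then show ?thesis by (simp only: real_sqrt_mult[of "\<sigma>2 * K * c"]) (simp only: mult_ac)
  qed
  finally have 1: "sqrt trace_variance * sqrt (variance R)
      \<le> real d * (sqrt (\<sigma>2 * K * c) * (\<bar>C\<bar> / sqrt (real d)))" .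
  \<comment> \<open>A factor sqrt(d) \<ge> 1 is given away here, to reach |C| / sqrt(d) instead of
    |C| / d.\<close>
  have "\<bar>C\<bar> * \<sigma>2 * real d * (1 + c) \<le> (real d)\<^sup>2 * ((\<sigma>2 * (1 + c)) * (\<bar>C\<bar> / sqrt (real d)))"
  proof -
    have "real d * 1 \<le> real d * sqrt (real d)" using d1 by (intro mult_left_mono) auto
    also have "\<dots> = (real d)\<^sup>2 / sqrt (real d)"
      using real_div_sqrt[of "real d"]
      by (simp only: power2_eq_square times_divide_eq_right[symmetric] of_nat_0_le_iff)
    finally have "real d \<le> (real d)\<^sup>2 / sqrt (real d)" by simp
    from mult_left_mono[OF this, of "\<bar>C\<bar> * \<sigma>2 * (1 + c)"] show ?thesis
      using sigma2_nonneg c by (simp add: mult_ac)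
  qed
  then have "sqrt (\<bar>C\<bar> * \<sigma>2 * real d * (1 + c))
      \<le> sqrt ((real d)\<^sup>2 * ((\<sigma>2 * (1 + c)) * (\<bar>C\<bar> / sqrt (real d))))"
    by (rule real_sqrt_le_mono)
  also have "\<dots> = real d * (sqrt (\<sigma>2 * (1 + c)) * sqrt (\<bar>C\<bar> / sqrt (real d)))"
    by (simp only: real_sqrt_mult real_sqrt_abs abs_of_nat)
  finally have "sqrt (\<bar>C\<bar> * \<sigma>2 * real d) * sqrt (1 + c)
      \<le> real d * (sqrt (\<sigma>2 * (1 + c)) * sqrt (\<bar>C\<bar> / sqrt (real d)))"
    by (simp only: real_sqrt_mult)
  moreover have "sqrt kernel_defect * sqrt (expectation (\<lambda>\<omega>. (R \<omega>)\<^sup>2))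
      \<le> sqrt (\<bar>C\<bar> * \<sigma>2 * real d) * sqrt (1 + c)"
    by (intro mult_mono real_sqrt_le_mono N Q) (use sigma2_nonneg in auto)
  ultimately have 2: "sqrt kernel_defect * sqrt (expectation (\<lambda>\<omega>. (R \<omega>)\<^sup>2))
      \<le> real d * (sqrt (\<sigma>2 * (1 + c)) * sqrt (\<bar>C\<bar> / sqrt (real d)))" by linarith
  have "Blam d \<sigma>2 M X T \<le> \<sigma>2 / real d *
      (real d * (sqrt (\<sigma>2 * K * c) * (\<bar>C\<bar> / sqrt (real d)))
        + 2 * (real d * (sqrt (\<sigma>2 * (1 + c)) * sqrt (\<bar>C\<bar> / sqrt (real d)))))"
    using sigma2_nonneg by (intro order_trans[OF Blam_le] mult_left_mono add_mono 1 2) auto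
  also have "\<dots> = \<sigma>2 * (sqrt (\<sigma>2 * K * c) * (\<bar>C\<bar> / sqrt (real d))
      + 2 * (sqrt (\<sigma>2 * (1 + c)) * sqrt (\<bar>C\<bar> / sqrt (real d))))"
    using d1 by (simp add: distrib_left del: real_sqrt_mult)
  finally show ?thesis by (simp only: K_def)
qed

end

section \<open>Asymptotics along the sequence of dimensions\<close>

lemma stein_settingI: "stein_problem d \<sigma>2 M X \<theta> T \<Longrightarrow> stein_setting M d \<sigma>2 X \<theta> T"
  by (auto simp: stein_setting_def stein_setting_axioms_def stein_problem_def)

lemma Blam_tendsto_fourth_moment:
  assumes prob: "\<forall>\<^sub>F d in sequentially. stein_problem d \<sigma>2 (M d) (X d) (\<theta> d) (T d)"
    and E4: "\<forall>\<^sub>F d in sequentially. (\<integral>\<omega>. 1 / (vnorm d (X d \<omega>)) ^ 4 \<partial>M d) \<le> C"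
    and V: "(\<lambda>d. \<integral>\<omega>. (mtrace d (T d (X d \<omega>)) - (\<integral>\<omega>'. mtrace d (T d (X d \<omega>')) \<partial>M d))\<^sup>2 \<partial>M d)
            \<in> o(\<lambda>d. (real d)\<^sup>2)" (is "?V \<in> _")
    and N: "(\<lambda>d. \<integral>\<omega>. (mnorm d (\<lambda>i j. T d (X d \<omega>) i j - \<sigma>2 * idm i j))\<^sup>2 \<partial>M d)
            \<in> o(\<lambda>d. (real d)\<^sup>2)" (is "?N \<in> _")
  shows "(\<lambda>d. Blam d \<sigma>2 (M d) (X d) (T d)) \<longlonglongrightarrow> 0"
proof (rule tendsto_sandwich[OF _ _ tendsto_const])
  show "\<forall>\<^sub>F d in sequentially. 0 \<le> Blam d \<sigma>2 (M d) (X d) (T d)" by (simp add: Blam_def)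
  show "\<forall>\<^sub>F d in sequentially. Blam d \<sigma>2 (M d) (X d) (T d)
      \<le> \<sigma>2 * sqrt C * (sqrt (?V d / (real d)\<^sup>2) + 2 * sqrt (?N d / (real d)\<^sup>2))"
    using prob E4
  proof eventually_elim
    case (elim d)
    then interpret stein_setting "M d" d \<sigma>2 "X d" "\<theta> d" "T d" by (intro stein_settingI)
    show ?case using Blam_le_fourth_moment elim(2) unfolding trace_variance_def kernel_defect_def .
  qed
  have "(\<lambda>d. \<sigma>2 * sqrt C * (sqrt (?V d / (real d)\<^sup>2) + 2 * sqrt (?N d / (real d)\<^sup>2)))
      \<longlonglongrightarrow> \<sigma>2 * sqrt C * (sqrt 0 + 2 * sqrt 0)"
    by (intro tendsto_intros smalloD_tendsto V N)
  then show "(\<lambda>d. \<sigma>2 * sqrt C * (sqrt (?V d / (real d)\<^sup>2) + 2 * sqrt (?N d / (real d)\<^sup>2))) \<longlonglongrightarrow> 0"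
    by simp
qed

lemma Blam_tendsto_poincare:
  assumes prob: "\<forall>\<^sub>F d in sequentially. stein_problem d \<sigma>2 (M d) (X d) (\<theta> d) (T d)"
    and P: "\<forall>\<^sub>F d in sequentially. poincare d (M d) (\<lambda>\<omega> i. sqrt (real d) * X d \<omega> i) (CP d) \<and>
               (\<integral>\<omega>. (mnorm d (T d (X d \<omega>)))\<^sup>2 \<partial>M d) \<le> CP d * \<sigma>2 * real d"
    and CP: "CP \<in> o(\<lambda>d. sqrt (real d))"
    and E6: "\<forall>\<^sub>F d in sequentially. integrable (M d) (\<lambda>\<omega>. 1 / (vnorm d (X d \<omega>)) ^ 6) \<and>
               (\<integral>\<omega>. 1 / (vnorm d (X d \<omega>)) ^ 6 \<partial>M d) \<le> C"
  shows "(\<lambda>d. Blam d \<sigma>2 (M d) (X d) (T d)) \<longlonglongrightarrow> 0"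
proof (rule tendsto_sandwich[OF _ _ tendsto_const])
  show "\<forall>\<^sub>F d in sequentially. 0 \<le> Blam d \<sigma>2 (M d) (X d) (T d)" by (simp add: Blam_def)
  let ?B = "\<lambda>d. \<sigma>2 * (sqrt (\<sigma>2 * (4 * (2 * exp 1 + 1)\<^sup>2) * C) * (\<bar>CP d\<bar> / sqrt (real d))
      + 2 * (sqrt (\<sigma>2 * (1 + C)) * sqrt (\<bar>CP d\<bar> / sqrt (real d))))"
  show "\<forall>\<^sub>F d in sequentially. Blam d \<sigma>2 (M d) (X d) (T d) \<le> ?B d"
    using prob P E6
  proof eventually_elim
    case (elim d)
    then interpret stein_setting "M d" d \<sigma>2 "X d" "\<theta> d" "T d" by (intro stein_settingI)
    show ?case using elim by (intro Blam_le_poincare) auto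
  qed
  have "(\<lambda>d. \<bar>CP d\<bar> / sqrt (real d)) \<longlonglongrightarrow> 0"
    using tendsto_rabs_zero[OF smalloD_tendsto[OF CP]] by simp
  then have "?B \<longlonglongrightarrow> \<sigma>2 * (sqrt (\<sigma>2 * (4 * (2 * exp 1 + 1)\<^sup>2) * C) * 0 + 2 * (sqrt (\<sigma>2 * (1 + C)) * sqrt 0))"
    by (intro tendsto_intros)
  then show "?B \<longlonglongrightarrow> 0" by simp
qed

theorem mainTheorem13:
  shows
  "(\<forall>(d::nat) (\<sigma>2::real) (M::'a measure) X \<theta> T.
      stein_problem d \<sigma>2 M X \<theta> T \<longrightarrow>
        integrable M (\<lambda>\<omega>. (vnorm d (\<lambda>i. shrink d (lam d \<sigma>2) (X \<omega>) i - \<theta> i))\<^sup>2) \<and>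
        (\<integral>\<omega>. (vnorm d (\<lambda>i. shrink d (lam d \<sigma>2) (X \<omega>) i - \<theta> i))\<^sup>2 \<partial>M)
          \<le> real d * (\<sigma>2 / real d)
             - (real d - 2)\<^sup>2 * (\<sigma>2 / real d)\<^sup>2 / ((vnorm d \<theta>)\<^sup>2 + real d * (\<sigma>2 / real d))
             + 2 * Blam d \<sigma>2 M X T)
   \<and>
   (\<forall>(\<sigma>2::real) (M::nat \<Rightarrow> 'a measure) X \<theta> T.
      (\<forall>\<^sub>F d in sequentially. stein_problem d \<sigma>2 (M d) (X d) (\<theta> d) (T d)) \<longrightarrow>
      ( \<comment> \<open>condition (a)\<close>
        ((\<exists>d0 C. \<forall>d\<ge>d0. integrable (M d) (\<lambda>\<omega>. 1 / (vnorm d (X d \<omega>)) ^ 4) \<and>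
                       (\<integral>\<omega>. 1 / (vnorm d (X d \<omega>)) ^ 4 \<partial>M d) \<le> C) \<and>
         (\<lambda>d. \<integral>\<omega>. (mtrace d (T d (X d \<omega>)) - (\<integral>\<omega>'. mtrace d (T d (X d \<omega>')) \<partial>M d))\<^sup>2 \<partial>M d)
            \<in> o(\<lambda>d. (real d)\<^sup>2) \<and>
         (\<lambda>d. \<integral>\<omega>. (mnorm d (\<lambda>i j. T d (X d \<omega>) i j - \<sigma>2 * idm i j))\<^sup>2 \<partial>M d)
            \<in> o(\<lambda>d. (real d)\<^sup>2))
       \<or> \<comment> \<open>condition (b)\<close>
        ((\<forall>\<^sub>F d in sequentially.
            sob_closure d (M d) (\<lambda>\<omega> i. sqrt (real d) * X d \<omega> i) (Cc_inf_vec d) (g0 d) (jac (g0 d))) \<and>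
         (\<exists>CP::nat \<Rightarrow> real. CP \<in> o(\<lambda>d. sqrt (real d)) \<and>
            (\<forall>\<^sub>F d in sequentially.
               poincare d (M d) (\<lambda>\<omega> i. sqrt (real d) * X d \<omega> i) (CP d) \<and>
               (\<integral>\<omega>. (mnorm d (T d (X d \<omega>)))\<^sup>2 \<partial>M d) \<le> CP d * \<sigma>2 * real d)) \<and>
         (\<exists>d0 C. \<forall>d\<ge>d0. integrable (M d) (\<lambda>\<omega>. 1 / (vnorm d (X d \<omega>)) ^ 6) \<and>
                       (\<integral>\<omega>. 1 / (vnorm d (X d \<omega>)) ^ 6 \<partial>M d) \<le> C)))
      \<longrightarrow> (\<lambda>d. Blam d \<sigma>2 (M d) (X d) (T d)) \<longlonglongrightarrow> 0)"
proof (intro conjI allI impI, goal_cases)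
  case (1 d \<sigma>2 M X \<theta> T)
  then show ?case by (rule stein_setting.shrink_risk(1)[OF stein_settingI])
next
  case (2 d \<sigma>2 M X \<theta> T)
  then show ?case by (rule stein_setting.shrink_risk(2)[OF stein_settingI])
next
  case prems: (3 \<sigma>2 M X \<theta> T)
  from prems(2) show ?case
  proof (elim disjE conjE exE)
    fix d0 C
    assume "\<forall>d\<ge>d0. integrable (M d) (\<lambda>\<omega>. 1 / (vnorm d (X d \<omega>)) ^ 4) \<and>
        (\<integral>\<omega>. 1 / (vnorm d (X d \<omega>)) ^ 4 \<partial>M d) \<le> C"
    then have "\<forall>\<^sub>F d in sequentially. (\<integral>\<omega>. 1 / (vnorm d (X d \<omega>)) ^ 4 \<partial>M d) \<le> C"
      by (auto simp: eventually_sequentially)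
    then show ?thesis if
      "(\<lambda>d. \<integral>\<omega>. (mtrace d (T d (X d \<omega>)) - (\<integral>\<omega>'. mtrace d (T d (X d \<omega>')) \<partial>M d))\<^sup>2 \<partial>M d)
        \<in> o(\<lambda>d. (real d)\<^sup>2)"
      "(\<lambda>d. \<integral>\<omega>. (mnorm d (\<lambda>i j. T d (X d \<omega>) i j - \<sigma>2 * idm i j))\<^sup>2 \<partial>M d) \<in> o(\<lambda>d. (real d)\<^sup>2)"
      using Blam_tendsto_fourth_moment[OF prems(1)] that by blast
  next
    fix CP d0 C
    assume CP: "CP \<in> o(\<lambda>d. sqrt (real d))"
      and P: "\<forall>\<^sub>F d in sequentially. poincare d (M d) (\<lambda>\<omega> i. sqrt (real d) * X d \<omega> i) (CP d) \<and>
        (\<integral>\<omega>. (mnorm d (T d (X d \<omega>)))\<^sup>2 \<partial>M d) \<le> CP d * \<sigma>2 * real d"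
      and "\<forall>d\<ge>d0. integrable (M d) (\<lambda>\<omega>. 1 / (vnorm d (X d \<omega>)) ^ 6) \<and>
        (\<integral>\<omega>. 1 / (vnorm d (X d \<omega>)) ^ 6 \<partial>M d) \<le> C"
    then have "\<forall>\<^sub>F d in sequentially. integrable (M d) (\<lambda>\<omega>. 1 / (vnorm d (X d \<omega>)) ^ 6) \<and>
        (\<integral>\<omega>. 1 / (vnorm d (X d \<omega>)) ^ 6 \<partial>M d) \<le> C"
      by (auto simp: eventually_sequentially)
    then show ?thesis by (rule Blam_tendsto_poincare[OF prems(1) P CP])
  qed
qed

end
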